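(* Let $L>0$, $\mathcal{M}>0$ and $k\in\mathbb{R}$. If $\mathcal{M}L<\frac12$ and $|k|$ is sufficiently small, in the sense that $|k|<1$, then the closed loop system $$(\delta_+)_t+(\delta_+)_x+\mathcal{M}\,\delta_-=0,\qquad (\delta_-)_t-(\delta_-)_x+\mathcal{M}\,\delta_+=0\qquad (t\ge 0,\ x\in(0,L)),$$ $$\delta_+(t,0)=k\,\delta_-(t,0),\qquad \delta_-(t,L)=\delta_+(t,L)\qquad (t\ge 0)$$ is exponentially stable for all initial states $(\delta_+(0,\cdot),\delta_-(0,\cdot))\in (H^1(0,L))^2$ with $\delta_+(0,L)=\delta_-(0,L)$ and $\delta_+(0,0)=k\,\delta_-(0,0)$.
   Context: The unknowns $\delta_+,\delta_-$ are real-valued functions of time $t\ge0$ and space $x\in(0,L)$. Exponential stability (for a class of initial states) means: there exist constants $C>0$ and $\mu>0$ such that for every initial state in the class the corresponding solution satisfies $\|(\delta_+(t,\cdot),\delta_-(t,\cdot))\|_{(L^2(0,L))^2}\le C e^{-\mu t}\|(\delta_+(0,\cdot),\delta_-(0,\cdot))\|_{(L^2(0,L))^2}$ for all $t\ge 0$. *)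

theory Defs
  imports "HOL-Analysis.Analysis"
begin

text \<open>Test functions \<open>C\<^sup>1\<^sub>c(\<Omega>)\<close>; the derivative of \<open>\<phi>\<close> at \<open>z\<close> in direction \<open>b\<close> is
  \<open>frechet_derivative \<phi> (at z) b\<close>.\<close>

definition test_functions :: "'a::euclidean_space set \<Rightarrow> ('a \<Rightarrow> real) set" where
  "test_functions \<Omega> = {\<phi>.
     (\<forall>z. \<phi> differentiable (at z)) \<and>
     (\<forall>b. continuous_on UNIV (\<lambda>z. frechet_derivative \<phi> (at z) b)) \<and>
     (\<exists>K. compact K \<and> K \<subseteq> \<Omega> \<and> (\<forall>z. z \<notin> K \<longrightarrow> \<phi> z = 0))}"

definition square_integrable_on :: "(real \<Rightarrow> real) \<Rightarrow> real set \<Rightarrow> bool"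
    (infix "square'_integrable'_on" 50) where
  "f square_integrable_on S \<longleftrightarrow>
     set_borel_measurable lborel S f \<and> set_integrable lborel S (\<lambda>x. (f x)\<^sup>2)"

text \<open>The Sobolev space \<open>H\<^sup>1(0,L)\<close> via weak derivatives. An element is represented by its
  continuous representative on \<open>[0,L]\<close>, so that the boundary values \<open>f 0\<close> and \<open>f L\<close> are its traces.
  Values outside \<open>[0,L]\<close> are irrelevant.\<close>

definition H1 :: "real \<Rightarrow> (real \<Rightarrow> real) set" where
  "H1 L = {f. continuous_on {0..L} f \<and> f square_integrable_on {0<..<L} \<and>
     (\<exists>g. g square_integrable_on {0<..<L} \<and>
       (\<forall>\<phi> \<in> test_functions {0<..<L}.
         (LINT x:{0<..<L}|lborel. f x * frechet_derivative \<phi> (at x) 1) =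
         - (LINT x:{0<..<L}|lborel. g x * \<phi> x)))}"

text \<open>The norm of \<open>(L\<^sup>2(0,L))\<^sup>2\<close>.\<close>

definition L2_norm2 :: "real \<Rightarrow> (real \<Rightarrow> real) \<Rightarrow> (real \<Rightarrow> real) \<Rightarrow> real" where
  "L2_norm2 L f g = sqrt ((LINT x:{0<..<L}|lborel. (f x)\<^sup>2) + (LINT x:{0<..<L}|lborel. (g x)\<^sup>2))"

text \<open>\<open>closed_loop_solution L M k a b p m\<close>: the pair \<open>p = \<delta>\<^sub>+\<close>, \<open>m = \<delta>\<^sub>-\<close> (functions of \<open>t\<close> and \<open>x\<close>)
  solves the closed loop system with initial state \<open>(a, b)\<close>. For initial states in \<open>H\<^sup>1\<close> the partial
  derivatives need not exist classically, so the equations \<open>p\<^sub>t + p\<^sub>x + M m = 0\<close> and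
  \<open>m\<^sub>t - m\<^sub>x + M p = 0\<close> are required in the sense of distributions on \<open>(0,\<infinity>) \<times> (0,L)\<close>; the
  derivatives are on the test function, whence the change of sign. Continuity up to the boundary
  makes the initial and boundary conditions meaningful pointwise.\<close>

definition closed_loop_solution ::
    "real \<Rightarrow> real \<Rightarrow> real \<Rightarrow> (real \<Rightarrow> real) \<Rightarrow> (real \<Rightarrow> real) \<Rightarrow>
     (real \<Rightarrow> real \<Rightarrow> real) \<Rightarrow> (real \<Rightarrow> real \<Rightarrow> real) \<Rightarrow> bool" where
  "closed_loop_solution L M k a b p m \<longleftrightarrow>
     continuous_on ({0..} \<times> {0..L}) (\<lambda>(t, x). p t x) \<and>
     continuous_on ({0..} \<times> {0..L}) (\<lambda>(t, x). m t x) \<and>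
     (\<forall>\<phi> \<in> test_functions ({0<..} \<times> {0<..<L}).
       set_lebesgue_integral lborel ({0<..} \<times> {0<..<L})
         (\<lambda>(t, x). - p t x * (frechet_derivative \<phi> (at (t, x)) (1, 0)
                              + frechet_derivative \<phi> (at (t, x)) (0, 1))
                   + M * m t x * \<phi> (t, x)) = 0) \<and>
     (\<forall>\<phi> \<in> test_functions ({0<..} \<times> {0<..<L}).
       set_lebesgue_integral lborel ({0<..} \<times> {0<..<L})
         (\<lambda>(t, x). - m t x * (frechet_derivative \<phi> (at (t, x)) (1, 0)
                              - frechet_derivative \<phi> (at (t, x)) (0, 1))
                   + M * p t x * \<phi> (t, x)) = 0) \<and>
     (\<forall>t\<ge>0. p t 0 = k * m t 0) \<and>
     (\<forall>t\<ge>0. m t L = p t L) \<and>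
     (\<forall>x\<in>{0..L}. p 0 x = a x \<and> m 0 x = b x)"

text \<open>Exponential stability for a class \<open>X\<close> of initial states. That there is \<^emph>\<open>the\<close> corresponding
  solution is part of the notion: each initial state in \<open>X\<close> has a solution, unique on
  \<open>[0,\<infinity>) \<times> [0,L]\<close>.\<close>

definition exponentially_stable ::
    "real \<Rightarrow> real \<Rightarrow> real \<Rightarrow> ((real \<Rightarrow> real) \<times> (real \<Rightarrow> real)) set \<Rightarrow> bool" where
  "exponentially_stable L M k X \<longleftrightarrow>
     (\<exists>C>0. \<exists>\<mu>>0. \<forall>(a, b) \<in> X. \<exists>p m.
        closed_loop_solution L M k a b p m \<and>
        (\<forall>p' m'. closed_loop_solution L M k a b p' m' \<longrightarrow>
           (\<forall>t\<ge>0. \<forall>x\<in>{0..L}. p' t x = p t x \<and> m' t x = m t x)) \<and>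
        (\<forall>t\<ge>0. L2_norm2 L (p t) (m t) \<le> C * exp (- \<mu> * t) * L2_norm2 L (p 0) (m 0)))"

end

theory Submission imports Defs begin

text \<open>
  The sum \<open>s = \<delta>\<^sub>+ + \<delta>\<^sub>-\<close> and the difference \<open>d = \<delta>\<^sub>+ - \<delta>\<^sub>-\<close> turn the closed loop system into
  \<open>s\<^sub>t + d\<^sub>x + M s = 0\<close>, \<open>d\<^sub>t + s\<^sub>x - M d = 0\<close> with \<open>d(t, L) = 0\<close> and \<open>d(t, 0) = - \<kappa> s(t, 0)\<close>, where
  \<open>\<kappa> = (1 - k) / (1 + k)\<close>. The hypothesis \<open>|k| < 1\<close> says that \<open>\<kappa> > 0\<close>, that is, that the left end
  absorbs energy. The zeroth order terms damp \<open>s\<close> but amplify \<open>d\<close>, so the \<open>L\<^sup>2\<close> norm itself need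
  not decrease, and the decay has to be read off from a different quadratic functional.

  The functional comes from a hidden wave equation. Every solution \<open>(s, d)\<close> is the time derivative
  of another solution \<open>(S, D)\<close>, the potential: \<open>D\<^sub>x = - (s + M S)\<close>, \<open>S\<^sub>x = M D - d\<close>, with the same
  boundary conditions. Since \<open>D\<^sub>t\<^sub>t = D\<^sub>x\<^sub>x + M\<^sup>2 D\<close>, the quantity
  \<open>F = 1/2 \<integral> (d\<^sup>2 + (s + M S)\<^sup>2 - M\<^sup>2 D\<^sup>2) + \<kappa> M / 2 S(0)\<^sup>2\<close> is an energy, and \<open>F' = - \<kappa> s(0)\<^sup>2\<close>.
  The mass term has the wrong sign, but \<open>D(L) = 0\<close> and \<open>M L < 1/2\<close> let the Poincare inequality
  absorb it, so \<open>F\<close> is equivalent to \<open>N = \<integral> (s\<^sup>2 + d\<^sup>2)\<close> (locale \<open>stationary_potential\<close>).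
  The multiplier term \<open>G = \<integral> 2 (L - x) s d\<close> satisfies \<open>G' = L (1 + \<kappa>\<^sup>2) s(0)\<^sup>2 - N\<close>, without
  any contribution of the zeroth order terms. Hence for small \<open>\<epsilon> > 0\<close> the functional \<open>F + \<epsilon> G\<close> is
  still equivalent to \<open>N\<close> and its derivative is at most \<open>- \<epsilon> N\<close>, which gives exponential decay
  (\<open>regular_solution_decay\<close>).

  This computation needs continuously differentiable solutions, while the solutions here are only
  continuous and satisfy the equations as distributions. A continuous function satisfies such a
  transport equation as a distribution if and only if it is differentiable along the
  characteristics (\<open>closed_loop_solution_iff_mild\<close>). Averages in time of such mild solutions are
  continuously differentiable solutions of the same system, because they trade the derivative in
  \<open>x\<close> for one in \<open>t\<close>; letting the width of the average tend to \<open>0\<close> transfers the decay estimate to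
  all mild solutions (\<open>mild_solution_decay\<close>).

  By linearity the decay estimate also gives uniqueness. For existence the interval is unfolded at
  \<open>x = L\<close>, which turns the pair \<open>(\<delta>\<^sub>+, \<delta>\<^sub>-)\<close> into one function on \<open>[0, 2 L]\<close> transported to the
  right; in an exponentially weighted supremum norm the solution formula along characteristics is a
  contraction (\<open>folded_transport_solution\<close>).
\<close>

section \<open>Continuously differentiable bump functions\<close>

lemma pos_part_square_deriv:
  "((\<lambda>y::real. (max 0 y)\<^sup>2) has_real_derivative 2 * max 0 y) (at y)"
proof -
  consider "y > 0" | "y < 0" | "y = 0" by linarith
  then show ?thesis
  proof cases
    case 1
    have "((\<lambda>y::real. y\<^sup>2) has_real_derivative 2 * max 0 y) (at y)"
      using 1 by (auto intro!: derivative_eq_intros)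
    then show ?thesis
      by (rule has_field_derivative_transform_within_open[where S="{0<..}"]) (use 1 in auto)
  next
    case 2
    have "((\<lambda>y::real. 0) has_real_derivative 2 * max 0 y) (at y)"
      using 2 by (auto intro!: derivative_eq_intros)
    then show ?thesis
      by (rule has_field_derivative_transform_within_open[where S="{..<0}"]) (use 2 in auto)
  next
    case 3
    have "(max 0 z)\<^sup>2 - (max 0 y)\<^sup>2 = max 0 z * (z - y)" for z
      using 3 by (auto simp: power2_eq_square max_def)
    moreover have "isCont (max 0) y"
      by (intro continuous_intros)
    ultimately have "\<exists>g. (\<forall>z. (max 0 z)\<^sup>2 - (max 0 y)\<^sup>2 = g z * (z - y)) \<and> isCont g y \<and> g y = 2 * max 0 y"
      using 3 by (intro exI[where x="max 0"]) auto
    then show ?thesis by (simp add: CARAT_DERIV)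
  qed
qed

text \<open>The square makes the truncated paraboloid \<open>r\<^sup>2 - |w|\<^sup>2\<close> continuously differentiable, which is all
  that is asked of a test function. The total mass is left unnormalised; only its positivity and
  its invariance under translation matter.\<close>

definition bump :: "real \<Rightarrow> 'a::euclidean_space \<Rightarrow> real" where
  "bump r w = (max 0 (r\<^sup>2 - w \<bullet> w))\<^sup>2"

definition bump_deriv :: "real \<Rightarrow> 'a::euclidean_space \<Rightarrow> 'a \<Rightarrow> real" where
  "bump_deriv r w v = - 4 * max 0 (r\<^sup>2 - w \<bullet> w) * (w \<bullet> v)"

lemma bump_has_derivative: "(bump r has_derivative bump_deriv r w) (at w)"
proof -
  have 1: "((\<lambda>w. r\<^sup>2 - w \<bullet> w) has_derivative (\<lambda>v. - 2 * (w \<bullet> v))) (at w)"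
    by (auto intro!: derivative_eq_intros simp: inner_commute)
  have "((\<lambda>w. (max 0 (r\<^sup>2 - w \<bullet> w))\<^sup>2) has_derivative
      (\<lambda>v. (- 2 * (w \<bullet> v)) * (2 * max 0 (r\<^sup>2 - w \<bullet> w)))) (at w)"
    using has_derivative_compose[OF 1 pos_part_square_deriv[unfolded has_field_derivative_def]]
    by (simp add: mult_ac)
  then show ?thesis
    by (simp add: bump_def[abs_def] bump_deriv_def[abs_def] mult_ac)
qed

lemma bump_nonneg: "bump r w \<ge> 0"
  by (simp add: bump_def)

lemma inner_self_le_iff: "0 \<le> r \<Longrightarrow> r\<^sup>2 \<le> w \<bullet> w \<longleftrightarrow> r \<le> norm (w::'a::euclidean_space)"
  by (metis dot_square_norm norm_ge_zero power2_le_imp_le power_mono)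

lemma bump_zero: "0 \<le> r \<Longrightarrow> r \<le> norm w \<Longrightarrow> bump r w = 0"
  using inner_self_le_iff[of r w] by (simp add: bump_def)

lemma bump_deriv_zero: "0 \<le> r \<Longrightarrow> r \<le> norm w \<Longrightarrow> bump_deriv r w v = 0"
  using inner_self_le_iff[of r w] by (simp add: bump_deriv_def)

lemma bump_pos: "0 < r \<Longrightarrow> bump r 0 > 0"
  by (simp add: bump_def max_def)

lemma bump_uminus: "bump r (- w) = bump r w"
  by (simp add: bump_def)

lemma continuous_on_bump [continuous_intros]:
  "continuous_on S g \<Longrightarrow> continuous_on S (\<lambda>x. bump r (g x))"
  unfolding bump_def by (intro continuous_intros)

lemma continuous_on_bump_deriv [continuous_intros]:
  "continuous_on S g \<Longrightarrow> continuous_on S (\<lambda>x. bump_deriv r (g x) v)"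
  unfolding bump_deriv_def by (intro continuous_intros)

lemma reflected_bump_deriv:
  "((\<lambda>w. bump r (c - w)) has_derivative (\<lambda>v. - bump_deriv r (c - w) v)) (at w)"
proof -
  have 1: "((\<lambda>w. c - w) has_derivative (\<lambda>v. - v)) (at w)"
    by (auto intro!: derivative_eq_intros)
  show ?thesis
    using has_derivative_compose[OF 1 bump_has_derivative[of r "c - w"]]
    by (simp add: bump_deriv_def)
qed

lemma reflected_bump_test_function:
  assumes "0 < r" "cball c r \<subseteq> \<Omega>"
  shows "(\<lambda>w. bump r (c - w)) \<in> test_functions \<Omega>"
proof -
  have D: "frechet_derivative (\<lambda>w. bump r (c - w)) (at w) = (\<lambda>v. - bump_deriv r (c - w) v)" for w
    using frechet_derivative_at[OF reflected_bump_deriv] by metis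
  have "continuous_on UNIV (\<lambda>w. - bump_deriv r (c - w) v)" for v
    by (intro continuous_intros)
  moreover have "bump r (c - w) = 0" if "w \<notin> cball c r" for w
    using that assms(1) by (intro bump_zero) (auto simp: dist_norm)
  moreover have "(\<lambda>w. bump r (c - w)) differentiable (at w)" for w
    using reflected_bump_deriv unfolding differentiable_def by blast
  ultimately show ?thesis
    unfolding test_functions_def
    using assms by (auto simp: D intro!: exI[where x="cball c r"])
qed

lemma bump_mass_translate:
  fixes c :: "'a::euclidean_space"
  shows "integral\<^sup>L lborel (\<lambda>w. bump r (c - w)) = integral\<^sup>L lborel (bump r :: 'a \<Rightarrow> real)"
proof -
  have m: "bump r \<in> borel_measurable (borel :: 'a measure)"
    by (intro borel_measurable_continuous_onI continuous_intros)
  have "integral\<^sup>L lborel (bump r :: 'a \<Rightarrow> real) = integral\<^sup>L (distr lborel borel ((+) (-c))) (bump r)"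
    by (simp add: lborel_distr_plus)
  also have "\<dots> = integral\<^sup>L lborel (\<lambda>w. bump r (- c + w))"
    by (rule integral_distr) (use m in auto)
  also have "(\<lambda>w. bump r (- c + w)) = (\<lambda>w. bump r (c - w))"
    using bump_uminus[of r] by (metis minus_diff_eq uminus_add_conv_diff)
  finally show ?thesis by simp
qed

section \<open>Distributional transport equations and derivatives along characteristics\<close>

lemma set_integral_eq_box_integral:
  fixes g :: "'a::euclidean_space \<Rightarrow> real"
  assumes "continuous_on (cbox a b) g" "cbox a b \<subseteq> \<Omega>"
    and "\<And>w. w \<in> \<Omega> \<Longrightarrow> w \<notin> cbox a b \<Longrightarrow> g w = 0"
  shows "(LINT w:\<Omega>|lborel. g w) = integral (cbox a b) g"
proof -
  have "(LINT w:\<Omega>|lborel. g w) = (LINT w:cbox a b|lborel. g w)"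
    unfolding set_lebesgue_integral_def
    by (rule Bochner_Integration.integral_cong) (use assms(2,3) in \<open>auto simp: indicator_def\<close>)
  also have "\<dots> = integral (cbox a b) g"
    by (rule set_borel_integral_eq_integral)
      (unfold set_integrable_def, intro borel_integrable_compact assms(1) compact_cbox)
  finally show ?thesis .
qed

lemma mollifier_mass_pos:
  fixes c :: "'a::euclidean_space"
  assumes "c \<in> box a b" "0 < r"
  shows "integral (cbox a b) (\<lambda>w. bump r (c - w)) > 0"
proof -
  let ?J = "integral (cbox a b) (\<lambda>w. bump r (c - w))"
  have cont: "continuous_on (cbox a b) (\<lambda>w. bump r (c - w))"
    by (intro continuous_intros)
  have "?J \<noteq> 0"
  proof
    assume "?J = 0"
    then have "((\<lambda>w. bump r (c - w)) has_integral 0) (cbox a b)"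
      using integrable_integral[OF integrable_continuous[OF cont]] by simp
    then have "bump r (c - c) = 0"
      using has_integral_0_cbox_imp_0[OF cont _ _ _, of c] assms box_subset_cbox[of a b]
      by (auto simp: bump_nonneg)
    then show False using bump_pos[OF assms(2), where 'a='a] by simp
  qed
  moreover have "?J \<ge> 0"
    by (rule integral_nonneg) (auto intro!: integrable_continuous cont simp: bump_nonneg)
  ultimately show ?thesis by simp
qed

text \<open>A bump of radius \<open>r\<close> around \<open>c\<close> sees only values of \<open>h\<close> that differ from \<open>y\<close> by at most \<open>\<eta>\<close>; this
  is the quantitative form of the convergence of mollifications.\<close>

lemma mollifier_error:
  fixes c :: "'a::euclidean_space"
  assumes h: "continuous_on (cbox a b) h" and "0 \<le> r"
    and close: "\<And>w. w \<in> cbox a b \<Longrightarrow> norm (c - w) < r \<Longrightarrow> \<bar>h w - y\<bar> \<le> \<eta>"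
  shows "\<bar>integral (cbox a b) (\<lambda>w. h w * bump r (c - w)) - y * integral (cbox a b) (\<lambda>w. bump r (c - w))\<bar>
    \<le> \<eta> * integral (cbox a b) (\<lambda>w. bump r (c - w))"
proof -
  note [continuous_intros] = h
  have "integral (cbox a b) (\<lambda>w. h w * bump r (c - w)) - y * integral (cbox a b) (\<lambda>w. bump r (c - w))
     = integral (cbox a b) (\<lambda>w. h w * bump r (c - w) - y * bump r (c - w))"
    by (subst Henstock_Kurzweil_Integration.integral_diff)
      (auto intro!: integrable_continuous continuous_intros)
  also have "norm \<dots> \<le> integral (cbox a b) (\<lambda>w. \<eta> * bump r (c - w))"
  proof (rule integral_norm_bound_integral)
    fix w assume w: "w \<in> cbox a b"
    show "norm (h w * bump r (c - w) - y * bump r (c - w)) \<le> \<eta> * bump r (c - w)"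
    proof (cases "norm (c - w) < r")
      case True
      have "norm (h w * bump r (c - w) - y * bump r (c - w)) = \<bar>h w - y\<bar> * bump r (c - w)"
        by (simp add: left_diff_distrib[symmetric] abs_mult bump_nonneg)
      then show ?thesis
        using mult_right_mono[OF close[OF w True] bump_nonneg[of r "c - w"]] by simp
    next
      case False
      then show ?thesis by (simp add: bump_zero[OF \<open>0 \<le> r\<close>])
    qed
  qed (auto intro!: integrable_continuous continuous_intros)
  finally show ?thesis by simp
qed

text \<open>Testing with a bump reflected about a point \<open>c\<close> shows that the mollification of \<open>u\<close> has directional
  derivative \<open>- f\<^sub>r\<close> in direction \<open>e\<close>, where \<open>f\<^sub>r\<close> is the mollification of \<open>f\<close>. As the radius of the
  bump shrinks, \<open>u\<^sub>r\<close> and \<open>f\<^sub>r\<close>, divided by the mass of the bump, converge uniformly along a short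
  segment in direction \<open>e\<close>, so the derivative passes to the limit.\<close>

lemma weak_imp_directional_derivative:
  fixes u f :: "'a::euclidean_space \<Rightarrow> real"
  assumes "open \<Omega>" and u: "continuous_on \<Omega> u" and f: "continuous_on \<Omega> f"
    and weak: "\<And>\<phi>. \<phi> \<in> test_functions \<Omega> \<Longrightarrow>
      (LINT z:\<Omega>|lborel. - u z * frechet_derivative \<phi> (at z) e + f z * \<phi> z) = 0"
    and z: "z \<in> \<Omega>"
  shows "((\<lambda>s. u (z + s *\<^sub>R e)) has_real_derivative - f z) (at 0)"
proof -
  obtain a b where ab: "z \<in> box a b" "cbox a b \<subseteq> \<Omega>"
    by (rule open_contains_cbox[OF \<open>open \<Omega>\<close> z])
  obtain R where R: "R > 0" "cball z (2 * R) \<subseteq> box a b"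
  proof -
    obtain R' where "R' > 0" "cball z R' \<subseteq> box a b"
      using open_contains_cball[of "box a b"] open_box ab(1) by blast
    then show ?thesis using that[of "R'/2"] by simp
  qed
  \<comment> \<open>the segment of parameters \<open>S\<close> stays within distance \<open>R\<close> of \<open>z\<close>, and bumps of radius at most \<open>R\<close>
     around its points stay inside the box; adding 1 covers the case \<open>e = 0\<close>\<close>
  define \<sigma> where "\<sigma> = R / (norm e + 1)"
  define S where "S = {-\<sigma>..\<sigma>}"
  have \<sigma>: "\<sigma> > 0" "\<sigma> * norm e \<le> R"
    using R(1) by (auto simp: \<sigma>_def field_simps add_pos_nonneg)
  define c where "c s = z + s *\<^sub>R e" for s
  have c: "dist z (c s) \<le> R" if "s \<in> S" for s
  proof -
    have "\<bar>s\<bar> * norm e \<le> \<sigma> * norm e" using that by (intro mult_right_mono) (auto simp: S_def)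
    then show ?thesis using \<sigma> by (simp add: c_def dist_norm)
  qed
  define r where "r n = R / real (Suc n)" for n
  have r: "r n > 0" "r n \<le> R" for n
    using R(1) by (auto simp: r_def field_simps)
  have sub: "cball (c s) (r n) \<subseteq> box a b" if "s \<in> S" for s n
  proof
    fix w assume "w \<in> cball (c s) (r n)"
    then have "dist z w \<le> 2 * R"
      using c[OF that] r(2)[of n] dist_triangle[of z w "c s"] by simp
    then show "w \<in> box a b" using R(2) by auto
  qed
  have subc: "cball (c s) (r n) \<subseteq> cbox a b" "c s \<in> box a b" if "s \<in> S" for s n
    using sub[OF that, of n] r(1)[of n] box_subset_cbox[of a b] by (auto simp: less_imp_le)
  note ucont = continuous_on_subset[OF u ab(2)] note fcont = continuous_on_subset[OF f ab(2)]
  define J where "J n = integral\<^sup>L lborel (bump (r n) :: 'a \<Rightarrow> real)" for n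
  define mol where "mol h n s = integral (cbox a b) (\<lambda>w. h w * bump (r n) (c s - w))"
    for h :: "'a \<Rightarrow> real" and n s
  have far: "r n \<le> norm (c s - w)" if "s \<in> S" "w \<notin> cbox a b" for s n w
  proof -
    have "w \<notin> cball (c s) (r n)" using subc(1)[OF that(1), of n] that(2) by blast
    then show ?thesis by (simp add: dist_norm)
  qed
  note zero = bump_zero[OF less_imp_le[OF r(1)] far]
  note zero' = bump_deriv_zero[OF less_imp_le[OF r(1)] far]
  have J: "integral (cbox a b) (\<lambda>w. bump (r n) (c s - w)) = J n" if "s \<in> S" for n s
  proof -
    have "integral (cbox a b) (\<lambda>w. bump (r n) (c s - w)) = (LINT w:UNIV|lborel. bump (r n) (c s - w))"
      by (rule set_integral_eq_box_integral[symmetric])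
        (use zero[OF that] in \<open>auto intro!: continuous_intros\<close>)
    also have "\<dots> = J n"
      by (simp add: set_lebesgue_integral_def bump_mass_translate J_def)
    finally show ?thesis .
  qed
  have Jpos: "J n > 0" for n
    using J[of 0 n] mollifier_mass_pos[OF subc(2)[of 0] r(1)[of n]] \<sigma>(1) by (simp add: S_def)
  have weak': "integral (cbox a b) (\<lambda>w. u w * bump_deriv (r n) (c s - w) e) = - mol f n s" if s: "s \<in> S" for n s
  proof -
    have D: "frechet_derivative (\<lambda>w. bump (r n) (c s - w)) (at w) = (\<lambda>v. - bump_deriv (r n) (c s - w) v)" for w
      using frechet_derivative_at[OF reflected_bump_deriv] by metis
    have "0 = (LINT w:\<Omega>|lborel. u w * bump_deriv (r n) (c s - w) e + f w * bump (r n) (c s - w))"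
      using weak[OF reflected_bump_test_function[of "r n" "c s"]] subc(1)[OF s, of n] ab(2) r(1)[of n]
      by (auto simp: D)
    also have "\<dots> = integral (cbox a b) (\<lambda>w. u w * bump_deriv (r n) (c s - w) e + f w * bump (r n) (c s - w))"
      by (rule set_integral_eq_box_integral)
        (use zero[OF s] zero'[OF s] ab in \<open>auto intro!: continuous_intros ucont fcont\<close>)
    also have "\<dots> = integral (cbox a b) (\<lambda>w. u w * bump_deriv (r n) (c s - w) e) + mol f n s"
      unfolding mol_def
      by (rule Henstock_Kurzweil_Integration.integral_add)
         (auto intro!: integrable_continuous continuous_intros ucont fcont)
    finally show ?thesis by simp
  qed
  have deriv: "(mol u n has_real_derivative - mol f n s) (at s within S)" if s: "s \<in> S" for n s
    unfolding weak'[OF s, symmetric] unfolding mol_def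
  proof (rule leibniz_rule_field_derivative[where U=S])
    fix s w
    have 1: "((\<lambda>s. c s - w) has_derivative (\<lambda>h. h *\<^sub>R e)) (at s within S)"
      unfolding c_def by (auto intro!: derivative_eq_intros)
    have "((\<lambda>s. bump (r n) (c s - w)) has_real_derivative bump_deriv (r n) (c s - w) e) (at s within S)"
      using has_derivative_compose[OF 1 bump_has_derivative[of "r n" "c s - w"]]
      unfolding has_field_derivative_def
      by (rule has_derivative_eq_rhs) (simp add: bump_deriv_def fun_eq_iff)
    then show "((\<lambda>s. u w * bump (r n) (c s - w)) has_real_derivative u w * bump_deriv (r n) (c s - w) e) (at s within S)"
      by (auto intro!: derivative_eq_intros)
  next
    fix s show "(\<lambda>w. u w * bump (r n) (c s - w)) integrable_on cbox a b"
      by (auto intro!: integrable_continuous continuous_intros ucont)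
  next
    show "continuous_on (S \<times> cbox a b) (\<lambda>(x, t). u t * bump_deriv (r n) (c x - t) e)"
      unfolding split_beta c_def
      by (auto intro!: continuous_intros continuous_on_compose2[OF ucont])
  qed (use s in \<open>auto simp: S_def\<close>)
  have approx: "\<forall>\<^sub>F n in sequentially. \<forall>s\<in>S. \<bar>mol h n s / J n - h (c s)\<bar> \<le> \<eta>"
    if h: "continuous_on (cbox a b) h" and "\<eta> > 0" for h \<eta>
  proof -
    have "uniformly_continuous_on (cbox a b) h"
      using h by (rule compact_uniformly_continuous) simp
    then obtain \<delta> where \<delta>: "\<delta> > 0"
      "\<And>x y. x \<in> cbox a b \<Longrightarrow> y \<in> cbox a b \<Longrightarrow> dist y x < \<delta> \<Longrightarrow> dist (h y) (h x) < \<eta>"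
      unfolding uniformly_continuous_on_def using \<open>\<eta> > 0\<close> by metis
    have "r \<longlonglongrightarrow> 0"
      unfolding r_def by (rule LIMSEQ_Suc) (rule lim_const_over_n)
    then have "\<forall>\<^sub>F n in sequentially. r n < \<delta>"
      using \<delta>(1) by (rule order_tendstoD)
    then show ?thesis
    proof eventually_elim
      case (elim n)
      show ?case
      proof
        fix s assume s: "s \<in> S"
        have "\<bar>mol h n s - h (c s) * J n\<bar> \<le> \<eta> * J n"
          unfolding mol_def J[OF s, symmetric]
        proof (rule mollifier_error[OF h])
          fix w assume "w \<in> cbox a b" "norm (c s - w) < r n"
          then show "\<bar>h w - h (c s)\<bar> \<le> \<eta>"
            using \<delta>(2)[of "c s" w] elim subc(2)[OF s] box_subset_cbox[of a b]
            by (auto simp: dist_norm norm_minus_commute less_imp_le)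
        qed (use r(1)[of n] in simp)
        moreover have "mol h n s / J n - h (c s) = (mol h n s - h (c s) * J n) / J n"
          using Jpos[of n] by (simp add: field_simps)
        ultimately show "\<bar>mol h n s / J n - h (c s)\<bar> \<le> \<eta>"
          using Jpos[of n] by (simp add: abs_divide field_simps)
      qed
    qed
  qed
  have lim: "(\<lambda>n. mol u n s / J n) \<longlonglongrightarrow> u (c s)" if "s \<in> S" for s
  proof (rule tendstoI)
    fix \<eta> :: real assume "\<eta> > 0"
    then have "\<forall>\<^sub>F n in sequentially. \<forall>s\<in>S. \<bar>mol u n s / J n - u (c s)\<bar> \<le> \<eta> / 2"
      by (intro approx ucont) simp
    then show "\<forall>\<^sub>F n in sequentially. dist (mol u n s / J n) (u (c s)) < \<eta>"
      by eventually_elim (use that \<open>\<eta> > 0\<close> in \<open>force simp: dist_real_def\<close>)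
  qed
  have "\<exists>g. \<forall>s\<in>S. (\<lambda>n. mol u n s / J n) \<longlonglongrightarrow> g s \<and> (g has_derivative (*) (- f (c s))) (at s within S)"
  proof (rule has_derivative_sequence)
    show "convex S" by (simp add: S_def)
    show "((\<lambda>s. mol u n s / J n) has_derivative (*) (- mol f n s / J n)) (at s within S)"
      if "s \<in> S" for n s
      using deriv[OF that, of n] Jpos[of n] unfolding has_field_derivative_def[symmetric]
      by (auto intro!: derivative_eq_intros)
    show "\<forall>\<^sub>F n in sequentially. \<forall>s\<in>S. \<forall>h. norm (- mol f n s / J n * h - - f (c s) * h) \<le> \<eta> * norm h"
      if "\<eta> > 0" for \<eta>
      using approx[OF fcont that]
    proof eventually_elim
      case (elim n)
      have "norm (- mol f n s / J n * h - - f (c s) * h) = \<bar>mol f n s / J n - f (c s)\<bar> * norm h" for s h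
      proof -
        have "- mol f n s / J n * h - - f (c s) * h = - (mol f n s / J n - f (c s)) * h"
          by (simp add: algebra_simps)
        then show ?thesis by (simp add: abs_mult abs_minus_commute)
      qed
      then show ?case using elim by (auto intro: mult_right_mono)
    qed
    show "0 \<in> S" using \<sigma> by (simp add: S_def)
    then show "(\<lambda>n. mol u n 0 / J n) \<longlonglongrightarrow> u (c 0)" by (rule lim)
  qed
  then obtain g where g: "\<And>s. s \<in> S \<Longrightarrow> (\<lambda>n. mol u n s / J n) \<longlonglongrightarrow> g s"
      "\<And>s. s \<in> S \<Longrightarrow> (g has_real_derivative - f (c s)) (at s within S)"
    unfolding has_field_derivative_def by blast
  have gu: "g s = u (c s)" if "s \<in> S" for s
    using g(1)[OF that] lim[OF that] LIMSEQ_unique by blast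
  have "((\<lambda>s. u (c s)) has_real_derivative - f (c 0)) (at 0 within S)"
    by (rule has_field_derivative_transform_within[OF g(2), where d=1]) (use gu \<sigma> in \<open>auto simp: S_def\<close>)
  moreover have "at 0 within S = at 0"
    by (rule at_within_interior) (use \<sigma> in \<open>simp add: S_def\<close>)
  ultimately show ?thesis by (simp add: c_def)
qed

lemma frechet_derivative_eq_0_off_support:
  assumes "closed K" "\<And>z. z \<notin> K \<Longrightarrow> \<phi> z = (0::real)" "z \<notin> K"
  shows "frechet_derivative \<phi> (at z) v = 0"
proof -
  have "((\<lambda>z. 0) has_derivative (\<lambda>v. 0)) (at z)" by simp
  then have "(\<phi> has_derivative (\<lambda>v. 0)) (at z)"
    by (rule has_derivative_transform_within_open[where s="-K"]) (use assms in auto)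
  then show ?thesis using frechet_derivative_at by metis
qed

lemma continuous_on_extend_by_0:
  fixes h :: "'a::t2_space \<Rightarrow> real"
  assumes "open \<Omega>" "continuous_on \<Omega> h" "compact K" "K \<subseteq> \<Omega>" "\<And>z. z \<in> \<Omega> - K \<Longrightarrow> h z = 0"
  shows "continuous_on UNIV (\<lambda>z. if z \<in> \<Omega> then h z else 0)"
proof -
  let ?g = "\<lambda>z. if z \<in> \<Omega> then h z else 0"
  have "continuous_on \<Omega> ?g"
    using assms(2) by (rule continuous_on_cong[THEN iffD1, rotated -1]) auto
  moreover have "continuous_on (- K) ?g"
    using assms(5) by (intro continuous_on_cong[THEN iffD1, OF refl _ continuous_on_const[of _ 0]]) auto
  ultimately have "continuous_on (\<Omega> \<union> - K) ?g"
    using assms(1,3) by (intro continuous_on_open_Un) (auto simp: compact_imp_closed open_Compl)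
  moreover have "\<Omega> \<union> - K = UNIV" using assms(4) by auto
  ultimately show ?thesis by simp
qed

text \<open>Translation invariance gives \<open>\<integral> (g(z + h e) - g(z)) dz = 0\<close> for every \<open>h\<close>. Divided by \<open>h\<close>, the
  integrand is bounded by the maximum of \<open>|g'|\<close> and vanishes off a fixed ball, so dominated
  convergence applies as \<open>h\<close> tends to \<open>0\<close>. This replaces integration by parts and needs no iterated
  integrals along the direction \<open>e\<close>.\<close>

lemma integral_directional_derivative_eq_0:
  fixes g g' :: "'a::euclidean_space \<Rightarrow> real"
  assumes g: "continuous_on UNIV g" and g': "continuous_on UNIV g'"
    and deriv: "\<And>z. ((\<lambda>s. g (z + s *\<^sub>R e)) has_real_derivative g' z) (at 0)"
    and "compact K" and off: "\<And>z. z \<notin> K \<Longrightarrow> g z = 0" "\<And>z. z \<notin> K \<Longrightarrow> g' z = 0"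
  shows "integral\<^sup>L lborel g' = 0"
proof -
  have deriv': "((\<lambda>s. g (z + s *\<^sub>R e)) has_real_derivative g' (z + s *\<^sub>R e)) (at s)" for z s
  proof -
    have "((\<lambda>t. g ((z + s *\<^sub>R e) + t *\<^sub>R e)) has_real_derivative g' (z + s *\<^sub>R e)) (at 0)"
      by (rule deriv)
    then have "((\<lambda>t. g (z + (t + s) *\<^sub>R e)) has_real_derivative g' (z + s *\<^sub>R e)) (at 0)"
      by (simp add: algebra_simps)
    then show ?thesis using DERIV_shift[of "\<lambda>s. g (z + s *\<^sub>R e)" _ 0 s] by simp
  qed
  have "bounded (g' ` K)"
    using \<open>compact K\<close> g' by (intro compact_imp_bounded compact_continuous_image) (auto intro: continuous_on_subset)
  then obtain B0 where B0: "\<And>z. z \<in> K \<Longrightarrow> \<bar>g' z\<bar> \<le> B0"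
    unfolding bounded_iff by auto
  define B where "B = max B0 0"
  have B: "\<bar>g' z\<bar> \<le> B" for z
    using B0[of z] off(2)[of z] by (cases "z \<in> K") (auto simp: B_def)
  obtain \<rho> where \<rho>: "\<And>z. z \<in> K \<Longrightarrow> norm z \<le> \<rho>"
    using compact_imp_bounded[OF \<open>compact K\<close>] unfolding bounded_iff by auto
  define h where "h n = 1 / real (Suc n)" for n
  have h: "h n > 0" "h n \<le> 1" "h n \<noteq> 0" for n by (auto simp: h_def)
  have h0: "h \<longlonglongrightarrow> 0"
    unfolding h_def by (rule LIMSEQ_Suc) (rule lim_const_over_n)
  define q where "q n z = (g (z + h n *\<^sub>R e) - g z) / h n" for n z
  have int: "integrable lborel g"
  proof -
    have "integrable lborel (\<lambda>x. indicator K x *\<^sub>R g x)"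
      by (rule borel_integrable_compact[OF \<open>compact K\<close>]) (rule continuous_on_subset[OF g], simp)
    moreover have "(\<lambda>x. indicator K x *\<^sub>R g x) = g" using off(1) by (auto simp: indicator_def fun_eq_iff)
    ultimately show ?thesis by simp
  qed
  have meas: "g \<in> borel_measurable borel" "g' \<in> borel_measurable borel"
    using g g' by (auto intro: borel_measurable_continuous_onI)
  have int_q: "integral\<^sup>L lborel (q n) = 0" for n
  proof -
    have eq: "integral\<^sup>L lborel (\<lambda>z. g (h n *\<^sub>R e + z)) = integral\<^sup>L lborel g"
      using integral_distr[of "(+) (h n *\<^sub>R e)" lborel borel g] meas by (simp add: lborel_distr_plus)
    have i: "integrable lborel (\<lambda>z. g (h n *\<^sub>R e + z))"
      using integrable_distr[of "(+) (h n *\<^sub>R e)" lborel borel g] meas int by (simp add: lborel_distr_plus)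
    have "integral\<^sup>L lborel (q n) = (integral\<^sup>L lborel (\<lambda>z. g (h n *\<^sub>R e + z)) - integral\<^sup>L lborel g) / h n"
      unfolding q_def using i int by (simp add: add.commute)
    then show ?thesis using eq by simp
  qed
  have lim: "(\<lambda>n. q n z) \<longlonglongrightarrow> g' z" for z
  proof -
    have "(\<lambda>t. (g (z + t *\<^sub>R e) - g z) / t) \<midarrow>0\<rightarrow> g' z"
      using deriv[of z] by (simp add: DERIV_def)
    moreover have "filterlim h (at 0) sequentially"
      using h0 h(3) by (simp add: filterlim_at)
    ultimately show ?thesis
      unfolding q_def by (rule filterlim_compose)
  qed
  have bound: "norm (q n z) \<le> B * indicator (cball 0 (\<rho> + norm e)) z" for n z
  proof (cases "z \<in> cball 0 (\<rho> + norm e)")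
    case True
    obtain l where "g (z + h n *\<^sub>R e) - g (z + 0 *\<^sub>R e) = (h n - 0) * g' (z + l *\<^sub>R e)"
      using MVT2[of 0 "h n" "\<lambda>s. g (z + s *\<^sub>R e)" "\<lambda>s. g' (z + s *\<^sub>R e)"] h(1)[of n] deriv' by blast
    then have "q n z = g' (z + l *\<^sub>R e)" using h(3)[of n] by (simp add: q_def)
    then show ?thesis using B True by simp
  next
    case False
    then have "norm z > \<rho> + norm e" by simp
    moreover have "norm (h n *\<^sub>R e) \<le> norm e"
      using h(1,2)[of n] mult_right_mono[of "h n" 1 "norm e"] by simp
    moreover have "norm z \<le> norm (z + h n *\<^sub>R e) + norm (h n *\<^sub>R e)"
      using norm_triangle_ineq4[of "z + h n *\<^sub>R e" "h n *\<^sub>R e"] by simp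
    ultimately have "norm z > \<rho>" "norm (z + h n *\<^sub>R e) > \<rho>" 
      using norm_ge_zero[of e] by linarith+
    then have "z \<notin> K" "z + h n *\<^sub>R e \<notin> K" using \<rho> by force+
    then show ?thesis using off(1) False by (simp add: q_def)
  qed
  have "(\<lambda>n. integral\<^sup>L lborel (q n)) \<longlonglongrightarrow> integral\<^sup>L lborel g'"
  proof (rule integral_dominated_convergence)
    show "g' \<in> borel_measurable lborel" using meas by simp
    show "q n \<in> borel_measurable lborel" for n
      unfolding q_def[abs_def] using meas by measurable
    show "integrable lborel (\<lambda>z::'a. B * indicator (cball 0 (\<rho> + norm e)) z :: real)"
      using emeasure_lborel_cball_finite[of "0::'a" "\<rho> + norm e"]
      by (intro integrable_mult_right integrable_real_indicator) (auto simp: less_top)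
  qed (use lim bound in auto)
  then show ?thesis using int_q by (simp add: LIMSEQ_const_iff)
qed

text \<open>Apply the previous lemma to \<open>u \<phi>\<close>, whose directional derivative is \<open>u D\<^sub>e\<phi> - f \<phi>\<close>. The function \<open>u\<close>
  itself need not be differentiable in any other direction.\<close>

lemma directional_derivative_imp_weak:
  fixes u f :: "'a::euclidean_space \<Rightarrow> real"
  assumes "open \<Omega>" and u: "continuous_on \<Omega> u" and f: "continuous_on \<Omega> f"
    and deriv: "\<And>z. z \<in> \<Omega> \<Longrightarrow> ((\<lambda>s. u (z + s *\<^sub>R e)) has_real_derivative - f z) (at 0)"
    and \<phi>: "\<phi> \<in> test_functions \<Omega>"
  shows "(LINT z:\<Omega>|lborel. - u z * frechet_derivative \<phi> (at z) e + f z * \<phi> z) = 0"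
proof -
  from \<phi> obtain K where K: "compact K" "K \<subseteq> \<Omega>" "\<And>z. z \<notin> K \<Longrightarrow> \<phi> z = 0"
    unfolding test_functions_def by auto
  have diff: "\<phi> differentiable (at z)" for z
    using \<phi> by (simp add: test_functions_def)
  define D where "D z = frechet_derivative \<phi> (at z) e" for z
  have Dcont: "continuous_on UNIV D"
    using \<phi> by (simp add: test_functions_def D_def[abs_def])
  have D0: "D z = 0" if "z \<notin> K" for z
    unfolding D_def using K that by (intro frechet_derivative_eq_0_off_support[of K]) (auto simp: compact_imp_closed)
  have \<phi>cont: "continuous_on UNIV \<phi>"
    using diff by (meson differentiable_imp_continuous_on differentiable_on_def differentiable_at_withinI)
  note [continuous_intros] = u f continuous_on_subset[OF \<phi>cont, simplified] continuous_on_subset[OF Dcont, simplified]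
  define g where "g z = (if z \<in> \<Omega> then u z * \<phi> z else 0)" for z
  define g' where "g' z = (if z \<in> \<Omega> then u z * D z - f z * \<phi> z else 0)" for z
  have line: "continuous_on UNIV (\<lambda>s::real. z + s *\<^sub>R e)" for z
    by (intro continuous_intros)
  have "((\<lambda>s. g (z + s *\<^sub>R e)) has_real_derivative g' z) (at 0)" for z
  proof (cases "z \<in> \<Omega>")
    case True
    have "((\<lambda>s. z + s *\<^sub>R e) has_derivative (\<lambda>h. h *\<^sub>R e)) (at 0)"
      by (auto intro!: derivative_eq_intros)
    moreover have "(\<phi> has_derivative frechet_derivative \<phi> (at z)) (at (z + 0 *\<^sub>R e))"
      using diff by (simp add: frechet_derivative_works)
    ultimately have "((\<lambda>s. \<phi> (z + s *\<^sub>R e)) has_derivative (\<lambda>h. frechet_derivative \<phi> (at z) (h *\<^sub>R e))) (at 0)"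
      using has_derivative_compose[of "\<lambda>s. z + s *\<^sub>R e" "\<lambda>h. h *\<^sub>R e" 0 UNIV \<phi>] by simp
    moreover have "linear (frechet_derivative \<phi> (at z))"
      using diff by (rule linear_frechet_derivative)
    ultimately have "((\<lambda>s. \<phi> (z + s *\<^sub>R e)) has_real_derivative D z) (at 0)"
      unfolding has_field_derivative_def
      by (elim has_derivative_eq_rhs) (simp add: fun_eq_iff D_def linear_cmul)
    then have "((\<lambda>s. u (z + s *\<^sub>R e) * \<phi> (z + s *\<^sub>R e)) has_real_derivative g' z) (at 0)"
      using deriv[OF True] by (auto intro!: derivative_eq_intros simp: g'_def True)
    moreover have "open ((\<lambda>s. z + s *\<^sub>R e) -` \<Omega>)"
      by (rule open_vimage[OF \<open>open \<Omega>\<close> line])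
    ultimately show ?thesis
      by (rule has_field_derivative_transform_within_open) (use True in \<open>auto simp: g_def\<close>)
  next
    case False
    have "((\<lambda>s. 0) has_real_derivative g' z) (at 0)"
      using False by (simp add: g'_def)
    moreover have "open ((\<lambda>s. z + s *\<^sub>R e) -` (- K))"
      by (rule open_vimage[OF _ line]) (use K in \<open>auto simp: compact_imp_closed open_Compl\<close>)
    ultimately show ?thesis
      by (rule has_field_derivative_transform_within_open) (use False K in \<open>auto simp: g_def\<close>)
  qed
  moreover have "continuous_on UNIV g"
    unfolding g_def by (rule continuous_on_extend_by_0[OF \<open>open \<Omega>\<close> _ K(1,2)]) (auto intro!: continuous_intros simp: K)
  moreover have "continuous_on UNIV g'"
    unfolding g'_def by (rule continuous_on_extend_by_0[OF \<open>open \<Omega>\<close> _ K(1,2)]) (auto intro!: continuous_intros simp: K D0)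
  ultimately have "integral\<^sup>L lborel g' = 0"
    by (intro integral_directional_derivative_eq_0[OF _ _ _ K(1), of g g' e])
      (use K(2) in \<open>auto simp: g_def g'_def K(3) D0\<close>)
  moreover have "(LINT z:\<Omega>|lborel. - u z * frechet_derivative \<phi> (at z) e + f z * \<phi> z) = (\<integral>z. - g' z \<partial>lborel)"
    unfolding set_lebesgue_integral_def D_def[symmetric]
    by (rule Bochner_Integration.integral_cong) (auto simp: g'_def indicator_def)
  ultimately show ?thesis by simp
qed

section \<open>Mild solutions of the closed loop system\<close>

text \<open>The equations are required as ordinary derivatives along the two families of characteristics
  \<open>x - t = const\<close> and \<open>x + t = const\<close>.\<close>

definition mild_solution :: "real \<Rightarrow> real \<Rightarrow> real \<Rightarrow> (real \<Rightarrow> real \<Rightarrow> real) \<Rightarrow> (real \<Rightarrow> real \<Rightarrow> real) \<Rightarrow> bool" where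
  "mild_solution L M k p m \<longleftrightarrow>
     continuous_on ({0..} \<times> {0..L}) (\<lambda>(t, x). p t x) \<and>
     continuous_on ({0..} \<times> {0..L}) (\<lambda>(t, x). m t x) \<and>
     (\<forall>t>0. \<forall>x. 0 < x \<longrightarrow> x < L \<longrightarrow>
       ((\<lambda>s. p (t + s) (x + s)) has_real_derivative - (M * m t x)) (at 0) \<and>
       ((\<lambda>s. m (t + s) (x - s)) has_real_derivative - (M * p t x)) (at 0)) \<and>
     (\<forall>t\<ge>0. p t 0 = k * m t 0) \<and>
     (\<forall>t\<ge>0. m t L = p t L)"


lemma weak_iff_directional_derivative:
  fixes u f :: "'a::euclidean_space \<Rightarrow> real"
  assumes "open \<Omega>" "continuous_on \<Omega> u" "continuous_on \<Omega> f"
  shows "(\<forall>\<phi> \<in> test_functions \<Omega>. (LINT z:\<Omega>|lborel. - u z * frechet_derivative \<phi> (at z) e + f z * \<phi> z) = 0)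
    \<longleftrightarrow> (\<forall>z\<in>\<Omega>. ((\<lambda>s. u (z + s *\<^sub>R e)) has_real_derivative - f z) (at 0))"
  using weak_imp_directional_derivative[OF assms] directional_derivative_imp_weak[OF assms] by blast

lemma closed_loop_solution_iff_mild:
  "closed_loop_solution L M k a b p m \<longleftrightarrow>
    mild_solution L M k p m \<and> (\<forall>x\<in>{0..L}. p 0 x = a x \<and> m 0 x = b x)"
proof (cases "continuous_on ({0..} \<times> {0..L}) (\<lambda>(t, x). p t x) \<and> continuous_on ({0..} \<times> {0..L}) (\<lambda>(t, x). m t x)")
  case True
  let ?\<Omega> = "{0<..} \<times> {0<..<L} :: (real \<times> real) set"
  have \<Omega>: "open ?\<Omega>" by (intro open_Times) auto
  have sub: "?\<Omega> \<subseteq> {0..} \<times> {0..L}" by auto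
  have cont: "continuous_on ?\<Omega> (\<lambda>z. p (fst z) (snd z))" "continuous_on ?\<Omega> (\<lambda>z. m (fst z) (snd z))"
    using True continuous_on_subset[OF _ sub] by (auto simp: split_beta)
  have D: "frechet_derivative \<phi> (at z) (1, 0) + frechet_derivative \<phi> (at z) (0, 1) = frechet_derivative \<phi> (at z) (1, 1)"
    "frechet_derivative \<phi> (at z) (1, 0) - frechet_derivative \<phi> (at z) (0, 1) = frechet_derivative \<phi> (at z) (1, - 1)"
    if "\<phi> \<in> test_functions ?\<Omega>" for \<phi> and z :: "real \<times> real"
  proof -
    have "linear (frechet_derivative \<phi> (at z))"
      using that unfolding test_functions_def by (intro linear_frechet_derivative) blast
    from linear_add[OF this, of "(1, 0)" "(0, 1)"] linear_diff[OF this, of "(1, 0)" "(0, 1)"]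
    show "frechet_derivative \<phi> (at z) (1, 0) + frechet_derivative \<phi> (at z) (0, 1) = frechet_derivative \<phi> (at z) (1, 1)"
      "frechet_derivative \<phi> (at z) (1, 0) - frechet_derivative \<phi> (at z) (0, 1) = frechet_derivative \<phi> (at z) (1, - 1)"
      by simp_all
  qed
  have "(\<forall>\<phi> \<in> test_functions ?\<Omega>. set_lebesgue_integral lborel ?\<Omega>
         (\<lambda>(t, x). - p t x * (frechet_derivative \<phi> (at (t, x)) (1, 0) + frechet_derivative \<phi> (at (t, x)) (0, 1))
                   + M * m t x * \<phi> (t, x)) = 0)
     \<longleftrightarrow> (\<forall>t>0. \<forall>x. 0 < x \<longrightarrow> x < L \<longrightarrow> ((\<lambda>s. p (t + s) (x + s)) has_real_derivative - (M * m t x)) (at 0))"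
    using weak_iff_directional_derivative[OF \<Omega> cont(1) continuous_on_mult_left[OF cont(2), of M], of "(1, 1)"]
    by (simp add: D case_prod_unfold Ball_def imp_conjL)
  moreover have "(\<forall>\<phi> \<in> test_functions ?\<Omega>. set_lebesgue_integral lborel ?\<Omega>
         (\<lambda>(t, x). - m t x * (frechet_derivative \<phi> (at (t, x)) (1, 0) - frechet_derivative \<phi> (at (t, x)) (0, 1))
                   + M * p t x * \<phi> (t, x)) = 0)
     \<longleftrightarrow> (\<forall>t>0. \<forall>x. 0 < x \<longrightarrow> x < L \<longrightarrow> ((\<lambda>s. m (t + s) (x - s)) has_real_derivative - (M * p t x)) (at 0))"
    using weak_iff_directional_derivative[OF \<Omega> cont(2) continuous_on_mult_left[OF cont(1), of M], of "(1, - 1)"]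
    by (simp add: D case_prod_unfold Ball_def imp_conjL)
  ultimately show ?thesis
    unfolding closed_loop_solution_def mild_solution_def by blast
qed (auto simp: closed_loop_solution_def mild_solution_def)


section \<open>Energy of the potential\<close>

lemma cauchy_schwarz_interval:
  fixes g :: "real \<Rightarrow> real"
  assumes "a \<le> b" and g: "continuous_on {a..b} g"
  shows "(integral {a..b} g)\<^sup>2 \<le> (b - a) * integral {a..b} (\<lambda>x. (g x)\<^sup>2)"
proof (cases "a = b")
  case False
  define c where "c = integral {a..b} g / (b - a)"
  have ba: "b - a > 0" using assms False by simp
  note [continuous_intros] = g
  have "0 \<le> integral {a..b} (\<lambda>x. (g x - c)\<^sup>2)"
    by (rule integral_nonneg) (auto intro!: integrable_continuous_real continuous_intros)
  also have "\<dots> = integral {a..b} (\<lambda>x. (g x)\<^sup>2 - 2 * c * g x + c\<^sup>2)"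
    by (simp add: power2_eq_square algebra_simps)
  also have "\<dots> = integral {a..b} (\<lambda>x. (g x)\<^sup>2) - 2 * c * integral {a..b} g + c\<^sup>2 * (b - a)"
    using assms(1)
    by (subst Henstock_Kurzweil_Integration.integral_add Henstock_Kurzweil_Integration.integral_diff;
        (auto intro!: integrable_continuous_real continuous_intros)?)+
  also have "\<dots> = integral {a..b} (\<lambda>x. (g x)\<^sup>2) - (integral {a..b} g)\<^sup>2 / (b - a)"
  proof -
    have "2 * c * integral {a..b} g = 2 * ((integral {a..b} g)\<^sup>2 / (b - a))"
      by (simp add: c_def power2_eq_square)
    moreover have "c\<^sup>2 * (b - a) = (integral {a..b} g)\<^sup>2 / (b - a)"
      using ba by (simp add: c_def power2_eq_square)
    ultimately show ?thesis by simp
  qed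
  finally show ?thesis using ba by (simp add: field_simps)
qed simp

text \<open>The Cauchy-Schwarz inequality for \<open>f y - f x = \<integral> f'\<close>: the one-dimensional Sobolev embedding behind
  the Poincare inequality and all pointwise bounds on the potential.\<close>

lemma increment_bound:
  fixes f f' :: "real \<Rightarrow> real"
  assumes f: "continuous_on {0..L} f" and f': "continuous_on {0..L} f'"
    and deriv: "\<And>x. 0 < x \<Longrightarrow> x < L \<Longrightarrow> (f has_real_derivative f' x) (at x)"
    and x: "0 \<le> x" "x \<le> y" "y \<le> L"
  shows "(f y - f x)\<^sup>2 \<le> L * integral {0..L} (\<lambda>x. (f' x)\<^sup>2)"
proof -
  note sub = continuous_on_subset[OF f] continuous_on_subset[OF f']
  note [continuous_intros] = f'
  have "(f' has_integral f y - f x) {x..y}"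
  proof (rule fundamental_theorem_of_calculus_interior[OF \<open>x \<le> y\<close>])
    show "continuous_on {x..y} f" by (rule sub) (use x in auto)
    show "(f has_vector_derivative f' z) (at z)" if "z \<in> {x<..<y}" for z
      using deriv[of z] that x by (simp add: has_real_derivative_iff_has_vector_derivative)
  qed
  then have "(f y - f x)\<^sup>2 = (integral {x..y} f')\<^sup>2"
    by (simp add: integral_unique)
  also have "\<dots> \<le> (y - x) * integral {x..y} (\<lambda>x. (f' x)\<^sup>2)"
    by (rule cauchy_schwarz_interval[OF x(2)]) (rule sub(2), use x in auto)
  also have "\<dots> \<le> L * integral {0..L} (\<lambda>x. (f' x)\<^sup>2)"
  proof (rule mult_mono)
    show "integral {x..y} (\<lambda>x. (f' x)\<^sup>2) \<le> integral {0..L} (\<lambda>x. (f' x)\<^sup>2)"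
      by (rule integral_subset_le)
        (use x in \<open>auto intro!: integrable_continuous_real continuous_intros sub(2)\<close>)
    show "0 \<le> integral {x..y} (\<lambda>x. (f' x)\<^sup>2)"
      by (rule integral_nonneg) (use x in \<open>auto intro!: integrable_continuous_real continuous_intros sub(2)\<close>)
  qed (use x in auto)
  finally show ?thesis .
qed

text \<open>The state at a fixed time together with its potential: \<open>(S, D)\<close> is mapped to \<open>(s, d)\<close> by the generator
  of the closed loop evolution. With \<open>s = S\<^sub>t\<close> and \<open>d = D\<^sub>t\<close> the two equations are the system itself.
  In this locale \<open>mass\<close> is the squared \<open>L\<^sup>2\<close> norm of the state, and \<open>w = - D\<^sub>x\<close>.\<close>

locale stationary_potential =
  fixes L M \<kappa> :: real and s d S D :: "real \<Rightarrow> real"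
  assumes L: "L > 0" and M: "M > 0" and ml_small: "M * L < 1 / 2" and \<kappa>: "\<kappa> > 0"
    and cont: "continuous_on {0..L} s" "continuous_on {0..L} d"
      "continuous_on {0..L} S" "continuous_on {0..L} D"
    and S_x: "\<And>x. 0 < x \<Longrightarrow> x < L \<Longrightarrow> (S has_real_derivative M * D x - d x) (at x)"
    and D_x: "\<And>x. 0 < x \<Longrightarrow> x < L \<Longrightarrow> (D has_real_derivative - (s x + M * S x)) (at x)"
    and D_L: "D L = 0" and D_0: "D 0 = - \<kappa> * S 0"
begin

lemmas [continuous_intros] = cont

abbreviation I :: "(real \<Rightarrow> real) \<Rightarrow> real" where "I \<equiv> integral {0..L}"

definition "mass = I (\<lambda>x. (s x)\<^sup>2 + (d x)\<^sup>2)"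
definition "energy = I (\<lambda>x. ((d x)\<^sup>2 + (s x + M * S x)\<^sup>2 - M\<^sup>2 * (D x)\<^sup>2) / 2) + \<kappa> * M / 2 * (S 0)\<^sup>2"

definition "w x = s x + M * S x"

lemma w_cont [continuous_intros]: "continuous_on {0..L} w"
  unfolding w_def by (intro continuous_intros)

lemma I_add: "continuous_on {0..L} f \<Longrightarrow> continuous_on {0..L} g \<Longrightarrow> I (\<lambda>x. f x + g x) = I f + I g"
  by (intro Henstock_Kurzweil_Integration.integral_add integrable_continuous_real)

lemma I_diff: "continuous_on {0..L} f \<Longrightarrow> continuous_on {0..L} g \<Longrightarrow> I (\<lambda>x. f x - g x) = I f - I g"
  by (intro Henstock_Kurzweil_Integration.integral_diff integrable_continuous_real)

lemma I_mono: "continuous_on {0..L} f \<Longrightarrow> continuous_on {0..L} g \<Longrightarrow> (\<And>x. f x \<le> g x) \<Longrightarrow> I f \<le> I g"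
  by (intro integral_le integrable_continuous_real)

lemma I_nonneg: "continuous_on {0..L} f \<Longrightarrow> (\<And>x. 0 \<le> f x) \<Longrightarrow> 0 \<le> I f"
  by (intro integral_nonneg integrable_continuous_real)

abbreviation "I\<^sub>s \<equiv> I (\<lambda>x. (s x)\<^sup>2)"
abbreviation "I\<^sub>d \<equiv> I (\<lambda>x. (d x)\<^sup>2)"
abbreviation "I\<^sub>w \<equiv> I (\<lambda>x. (w x)\<^sup>2)"
abbreviation "I\<^sub>D \<equiv> I (\<lambda>x. (D x)\<^sup>2)"

lemma nonneg: "I\<^sub>s \<ge> 0" "I\<^sub>d \<ge> 0" "I\<^sub>w \<ge> 0" "I\<^sub>D \<ge> 0"
  by (auto intro!: I_nonneg continuous_intros)

lemma ml_small_sq: "M\<^sup>2 * L\<^sup>2 \<le> 1 / 4"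
proof -
  have "(M * L)\<^sup>2 \<le> (1 / 2)\<^sup>2" using ml_small M L by (intro power_mono) auto
  then show ?thesis by (simp add: power_mult_distrib power_divide)
qed

lemma mass_eq: "mass = I\<^sub>s + I\<^sub>d"
  unfolding mass_def by (intro I_add continuous_intros)

lemma energy_eq: "2 * energy = I\<^sub>d + I\<^sub>w - M\<^sup>2 * I\<^sub>D + \<kappa> * M * (S 0)\<^sup>2"
proof -
  have "I (\<lambda>x. ((d x)\<^sup>2 + (w x)\<^sup>2 - M\<^sup>2 * (D x)\<^sup>2) / 2) = (I\<^sub>d + I\<^sub>w - M\<^sup>2 * I\<^sub>D) / 2"
    by (simp add: I_add I_diff continuous_intros)
  then show ?thesis by (simp add: energy_def w_def field_simps)
qed

lemma D_square_le: "0 \<le> x \<Longrightarrow> x \<le> L \<Longrightarrow> (D x)\<^sup>2 \<le> L * I\<^sub>w"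
  using increment_bound[of L D "\<lambda>x. - (s x + M * S x)" x L] D_x D_L
  by (simp add: w_def[symmetric] continuous_intros w_cont)

lemma poincare: "M\<^sup>2 * I\<^sub>D \<le> I\<^sub>w / 4"
proof -
  have "I\<^sub>D \<le> I (\<lambda>x. L * I\<^sub>w)"
    by (rule integral_le) (auto intro!: integrable_continuous_real continuous_intros D_square_le)
  also have "\<dots> = L\<^sup>2 * I\<^sub>w" using L by (simp add: power2_eq_square)
  finally have "M\<^sup>2 * I\<^sub>D \<le> M\<^sup>2 * (L\<^sup>2 * I\<^sub>w)" by (intro mult_left_mono) auto
  also have "\<dots> \<le> 1 / 4 * I\<^sub>w"
    unfolding mult.assoc[symmetric] by (rule mult_right_mono[OF ml_small_sq nonneg(3)])
  finally show ?thesis by simp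
qed

text \<open>Integrating \<open>(D S)\<^sub>x\<close> over the interval; the boundary terms produce \<open>\<kappa> S(0)\<^sup>2\<close>. The left-hand side is the
  part of twice the energy that involves the potential, and the right-hand side is linear in \<open>(s, d)\<close>,
  which is what makes the energy controllable by the state.\<close>

lemma virial: "I\<^sub>w - M\<^sup>2 * I\<^sub>D + M * \<kappa> * (S 0)\<^sup>2 = I (\<lambda>x. w x * s x) - M * I (\<lambda>x. D x * d x)"
proof -
  have "((\<lambda>x. - w x * S x + D x * (M * D x - d x)) has_integral D L * S L - D 0 * S 0) {0..L}"
  proof (rule fundamental_theorem_of_calculus_interior)
    show "continuous_on {0..L} (\<lambda>x. D x * S x)" by (intro continuous_intros)
    fix x assume "x \<in> {0<..<L}"
    then show "((\<lambda>x. D x * S x) has_vector_derivative - w x * S x + D x * (M * D x - d x)) (at x)"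
      unfolding has_real_derivative_iff_has_vector_derivative[symmetric]
      using S_x[of x] D_x[of x] by (auto intro!: derivative_eq_intros simp: w_def)
  qed (use L in simp)
  then have "I (\<lambda>x. - w x * S x + D x * (M * D x - d x)) = \<kappa> * (S 0)\<^sup>2"
    using D_L D_0 by (simp add: integral_unique power2_eq_square)
  then have "M * \<kappa> * (S 0)\<^sup>2 = M * I (\<lambda>x. - w x * S x + D x * (M * D x - d x))"
    by simp
  also have "\<dots> = I (\<lambda>x. M * (- w x * S x + D x * (M * D x - d x)))"
    by (simp only: integral_mult_right)
  also have "(\<lambda>x. M * (- w x * S x + D x * (M * D x - d x)))
      = (\<lambda>x. - (w x)\<^sup>2 + w x * s x + M\<^sup>2 * (D x)\<^sup>2 - M * (D x * d x))"
    by (auto simp: w_def power2_eq_square algebra_simps)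
  also have "I \<dots> = - I\<^sub>w + I (\<lambda>x. w x * s x) + M\<^sup>2 * I\<^sub>D - M * I (\<lambda>x. D x * d x)"
    by (simp add: I_add I_diff continuous_intros)
  finally show ?thesis by simp
qed

text \<open>By Young's inequality the right-hand side of the virial identity is at most
  \<open>\<integral> w\<^sup>2 / 4 + M\<^sup>2 \<integral> D\<^sup>2\<close> plus a multiple of the mass; the Poincare inequality absorbs the first two
  terms into the left-hand side.\<close>

lemma energy_le_mass: "energy \<le> 2 * mass"
proof -
  have 1: "I (\<lambda>x. w x * s x) \<le> I (\<lambda>x. (w x)\<^sup>2 / 4 + (s x)\<^sup>2)"
  proof (rule I_mono)
    show "w x * s x \<le> (w x)\<^sup>2 / 4 + (s x)\<^sup>2" for x
      using zero_le_power2[of "w x / 2 - s x"] by (simp add: power2_eq_square algebra_simps)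
  qed (auto intro!: continuous_intros)
  have 2: "I (\<lambda>x. - M * (D x * d x)) \<le> I (\<lambda>x. M\<^sup>2 * (D x)\<^sup>2 + (d x)\<^sup>2 / 4)"
  proof (rule I_mono)
    show "- M * (D x * d x) \<le> M\<^sup>2 * (D x)\<^sup>2 + (d x)\<^sup>2 / 4" for x
      using zero_le_power2[of "M * D x + d x / 2"] by (simp add: power2_eq_square algebra_simps)
  qed (auto intro!: continuous_intros)
  have 3: "I (\<lambda>x. w x * s x) \<le> I\<^sub>w / 4 + I\<^sub>s" "- M * I (\<lambda>x. D x * d x) \<le> M\<^sup>2 * I\<^sub>D + I\<^sub>d / 4"
    using 1 2 by (simp_all add: I_add continuous_intros)
  have "0 \<le> M * \<kappa> * (S 0)\<^sup>2" using M \<kappa> by simp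
  then show ?thesis
    using 3 virial poincare energy_eq mass_eq nonneg by (simp add: mult.commute)
qed

lemma energy_coercive: "3 / 8 * (I\<^sub>w + I\<^sub>d) \<le> energy"
proof -
  have "0 \<le> \<kappa> * M * (S 0)\<^sup>2" using M \<kappa> by simp
  then show ?thesis using energy_eq poincare nonneg by (simp add: field_simps)
qed

text \<open>The energy controls \<open>X = \<integral> (D\<^sub>x\<^sup>2 + d\<^sup>2)\<close>. To recover \<open>s = - D\<^sub>x - M S\<close> one also has to bound \<open>S\<close>: its
  boundary value is \<open>S(0) = - D(0) / \<kappa>\<close>, and \<open>S\<^sub>x = M D - d\<close>.\<close>

lemma mass_le_energy: "mass \<le> 8 / 3 * (4 + 1 / \<kappa>\<^sup>2) * energy"
proof -
  define X where "X = I\<^sub>w + I\<^sub>d"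
  have X: "X \<ge> 0" "I\<^sub>w \<le> X" using nonneg by (auto simp: X_def)
  have "(S 0)\<^sup>2 = (D 0)\<^sup>2 / \<kappa>\<^sup>2" using D_0 \<kappa> by (simp add: power_mult_distrib)
  also have "\<dots> \<le> L * X / \<kappa>\<^sup>2"
    using L X(2) by (intro divide_right_mono order_trans[OF D_square_le[of 0]] mult_left_mono) auto
  finally have S0: "(S 0)\<^sup>2 \<le> L * X / \<kappa>\<^sup>2" .
  have Sx: "I (\<lambda>x. (M * D x - d x)\<^sup>2) \<le> 2 * X"
  proof -
    have "I (\<lambda>x. (M * D x - d x)\<^sup>2) \<le> I (\<lambda>x. 2 * (M\<^sup>2 * (D x)\<^sup>2) + 2 * (d x)\<^sup>2)"
    proof (rule I_mono)
      show "(M * D x - d x)\<^sup>2 \<le> 2 * (M\<^sup>2 * (D x)\<^sup>2) + 2 * (d x)\<^sup>2" for x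
        using zero_le_power2[of "M * D x + d x"] by (simp add: power2_eq_square algebra_simps)
    qed (intro continuous_intros)+
    also have "\<dots> = 2 * (M\<^sup>2 * I\<^sub>D) + 2 * I\<^sub>d" by (simp add: I_add continuous_intros)
    also have "\<dots> \<le> 2 * X" using poincare nonneg by (simp add: X_def)
    finally show ?thesis .
  qed
  have S: "(S x)\<^sup>2 \<le> 2 * L * X / \<kappa>\<^sup>2 + 4 * L * X" if "x \<in> {0..L}" for x
  proof -
    have "(S x - S 0)\<^sup>2 \<le> L * I (\<lambda>x. (M * D x - d x)\<^sup>2)"
      by (rule increment_bound) (use that S_x in \<open>auto intro!: continuous_intros\<close>)
    also have "\<dots> \<le> L * (2 * X)" using Sx L by (intro mult_left_mono) auto
    finally have "(S x - S 0)\<^sup>2 \<le> 2 * L * X" by simp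
    moreover have "(S x)\<^sup>2 \<le> 2 * (S 0)\<^sup>2 + 2 * (S x - S 0)\<^sup>2"
      using zero_le_power2[of "S x - 2 * S 0"] by (simp add: power2_eq_square algebra_simps)
    ultimately show ?thesis using S0 by simp
  qed
  have "I (\<lambda>x. (S x)\<^sup>2) \<le> I (\<lambda>x. 2 * L * X / \<kappa>\<^sup>2 + 4 * L * X)"
    by (rule integral_le) (use S in \<open>auto intro!: integrable_continuous_real continuous_intros\<close>)
  also have "\<dots> = L\<^sup>2 * (2 / \<kappa>\<^sup>2 + 4) * X"
    using L by (simp add: power2_eq_square algebra_simps)
  finally have "2 * M\<^sup>2 * I (\<lambda>x. (S x)\<^sup>2) \<le> 2 * M\<^sup>2 * (L\<^sup>2 * (2 / \<kappa>\<^sup>2 + 4) * X)"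
    by (intro mult_left_mono) auto
  also have "\<dots> = M\<^sup>2 * L\<^sup>2 * ((4 / \<kappa>\<^sup>2 + 8) * X)" by (simp add: algebra_simps)
  also have "\<dots> \<le> 1 / 4 * ((4 / \<kappa>\<^sup>2 + 8) * X)"
    using ml_small_sq X(1) by (intro mult_right_mono) auto
  finally have S_bound: "2 * M\<^sup>2 * I (\<lambda>x. (S x)\<^sup>2) \<le> X / \<kappa>\<^sup>2 + 2 * X" by (simp add: algebra_simps)
  have "I\<^sub>s \<le> I (\<lambda>x. 2 * (w x)\<^sup>2 + 2 * M\<^sup>2 * (S x)\<^sup>2)"
  proof (rule I_mono)
    show "(s x)\<^sup>2 \<le> 2 * (w x)\<^sup>2 + 2 * M\<^sup>2 * (S x)\<^sup>2" for x
      using zero_le_power2[of "w x + M * S x"] by (simp add: w_def power2_eq_square algebra_simps)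
  qed (auto intro!: continuous_intros)
  also have "\<dots> = 2 * I\<^sub>w + 2 * M\<^sup>2 * I (\<lambda>x. (S x)\<^sup>2)" by (simp add: I_add continuous_intros)
  finally have "mass \<le> (4 + 1 / \<kappa>\<^sup>2) * X"
    using S_bound nonneg by (simp add: mass_eq X_def algebra_simps add_divide_distrib)
  also have "\<dots> \<le> (4 + 1 / \<kappa>\<^sup>2) * (8 / 3 * energy)"
    using energy_coercive by (intro mult_left_mono) (auto simp: X_def)
  finally show ?thesis by (simp only: mult_ac)
qed

end

text \<open>For \<open>s = d = 0\<close> the equations for \<open>(S, D)\<close> are a rotation with angular velocity \<open>M\<close>, so variation of
  constants in the rotating frame \<open>(A, B)\<close> solves them explicitly. The remaining constant \<open>c = S(0)\<close> is
  determined by \<open>D(L) = 0\<close>, because its coefficient \<open>sin(M L) + \<kappa> cos(M L)\<close> is positive for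
  \<open>0 < M L < \<pi> / 2\<close>: zero is not an eigenvalue of the generator.\<close>

lemma stationary_potential_exists:
  fixes L M \<kappa> :: real
  assumes "L > 0" "M > 0" "M * L < 1 / 2" "\<kappa> > 0"
    and s: "continuous_on {0..L} s" and d: "continuous_on {0..L} d"
  shows "\<exists>S D. stationary_potential L M \<kappa> s d S D"
proof -
  define a where "a x = cos (M * x) * d x - sin (M * x) * s x" for x
  define b where "b x = sin (M * x) * d x + cos (M * x) * s x" for x
  have cont: "continuous_on {0..L} a" "continuous_on {0..L} b"
    unfolding a_def b_def by (intro continuous_intros s d)+
  have ml_small: "0 < M * L" "M * L < pi / 2" "M * L < pi"
    using assms pi_gt3 by (auto intro: less_trans[of _ "1/2"])
  define q where "q = sin (M * L) + \<kappa> * cos (M * L)"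
  have q: "q > 0"
    unfolding q_def using ml_small assms by (intro add_pos_pos mult_pos_pos sin_gt_zero cos_gt_zero) auto
  define c where "c = (sin (M * L) * integral {0..L} a - cos (M * L) * integral {0..L} b) / q"
  define A where "A x = c - integral {0..x} a" for x
  define B where "B x = - \<kappa> * c - integral {0..x} b" for x
  have deriv: "(A has_real_derivative - a x) (at x)" "(B has_real_derivative - b x) (at x)"
    if "0 < x" "x < L" for x
  proof -
    have i: "((\<lambda>x. integral {0..x} h) has_real_derivative h x) (at x)" if "continuous_on {0..L} h" for h :: "real \<Rightarrow> real"
    proof -
      have "((\<lambda>x. integral {0..x} h) has_real_derivative h x) (at x within {0..L})"
        by (rule integral_has_real_derivative[OF that]) (use \<open>0 < x\<close> \<open>x < L\<close> in auto)
      moreover have "at x within {0..L} = at x"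
        by (rule at_within_interior) (use \<open>0 < x\<close> \<open>x < L\<close> in simp)
      ultimately show ?thesis by simp
    qed
    show "(A has_real_derivative - a x) (at x)" "(B has_real_derivative - b x) (at x)"
      unfolding A_def B_def using i[OF cont(1)] i[OF cont(2)] by (auto intro!: derivative_eq_intros)
  qed
  have AB: "continuous_on {0..L} A" "continuous_on {0..L} B"
    unfolding A_def B_def
    by (intro continuous_intros indefinite_integral_continuous_1 integrable_continuous_real cont)+
  define S where "S x = cos (M * x) * A x + sin (M * x) * B x" for x
  define D where "D x = - sin (M * x) * A x + cos (M * x) * B x" for x
  have trig: "cos y * (cos y * p - sin y * r) + sin y * (sin y * p + cos y * r) = p"
    "cos y * (sin y * p + cos y * r) - sin y * (cos y * p - sin y * r) = r" for y p r :: real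
    using sin_cos_squared_add[of y] unfolding power2_eq_square by algebra+
  have "stationary_potential L M \<kappa> s d S D"
  proof
    show "continuous_on {0..L} S" "continuous_on {0..L} D"
      unfolding S_def D_def by (intro continuous_intros AB)+
    show "(S has_real_derivative M * D x - d x) (at x)" if "0 < x" "x < L" for x
    proof -
      have "(S has_real_derivative M * D x - (cos (M * x) * a x + sin (M * x) * b x)) (at x)"
        unfolding S_def
        by (rule derivative_eq_intros refl deriv that | simp)+ (simp add: D_def algebra_simps)
      then show ?thesis unfolding a_def b_def trig .
    qed
    show "(D has_real_derivative - (s x + M * S x)) (at x)" if "0 < x" "x < L" for x
    proof -
      have "(D has_real_derivative - ((cos (M * x) * b x - sin (M * x) * a x) + M * S x)) (at x)"
        unfolding D_def
        by (rule derivative_eq_intros refl deriv that | simp)+ (simp add: S_def algebra_simps)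
      then show ?thesis unfolding a_def b_def trig .
    qed
    show "D 0 = - \<kappa> * S 0" by (simp add: D_def S_def A_def B_def)
    have "D L = sin (M * L) * integral {0..L} a - cos (M * L) * integral {0..L} b - c * q"
      by (simp add: D_def A_def B_def q_def algebra_simps)
    then show "D L = 0" using q by (simp add: c_def)
  qed (use assms in auto)
  then show ?thesis by blast
qed

section \<open>Lyapunov functional for continuously differentiable solutions\<close>

text \<open>Moves a variable end point into the integrand, so that continuity in parameters can be read off from
  an integral over a fixed interval.\<close>

lemma integral_rescale:
  fixes g :: "real \<Rightarrow> real"
  assumes "0 \<le> t" "continuous_on {0..t} g"
  shows "integral {0..t} g = t * integral {0..1} (\<lambda>\<theta>. g (t * \<theta>))"
proof -
  have "((\<lambda>\<theta>. t *\<^sub>R g (t * \<theta>)) has_integral integral {t * 0..t * 1} g) {0..1}"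
  proof (rule has_integral_substitution[where c=0 and d=t])
    show "(\<lambda>\<theta>. t * \<theta>) ` {0..1} \<subseteq> {0..t}"
      using assms(1) by (auto simp: mult_left_le)
    show "((\<lambda>\<theta>. t * \<theta>) has_real_derivative t) (at \<theta> within {0..1})" for \<theta>
      by (auto intro!: derivative_eq_intros)
  qed (use assms in auto)
  from integral_unique[OF this] show ?thesis by simp
qed

lemma continuous_on_compose_pair:
  assumes "continuous_on (S \<times> T) (\<lambda>(t, x). f t x)"
    and "continuous_on A g" "continuous_on A h" "\<And>z. z \<in> A \<Longrightarrow> g z \<in> S" "\<And>z. z \<in> A \<Longrightarrow> h z \<in> T"
  shows "continuous_on A (\<lambda>z. f (g z) (h z))"
proof -
  have "continuous_on A (\<lambda>z. (\<lambda>(t, x). f t x) (g z, h z))"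
    by (rule continuous_on_compose2[OF assms(1)]) (use assms in \<open>auto intro!: continuous_intros\<close>)
  then show ?thesis by simp
qed

lemma continuous_on_time_integral:
  fixes f :: "real \<Rightarrow> 'a::metric_space \<Rightarrow> real"
  assumes f: "continuous_on ({0..} \<times> X) (\<lambda>(t, x). f t x)"
  shows "continuous_on ({0..} \<times> X) (\<lambda>(t, x). integral {0..t} (\<lambda>\<tau>. f \<tau> x))"
proof -
  have cont: "continuous_on ({0..} \<times> X) (\<lambda>z. fst z * integral {0..1} (\<lambda>\<theta>. f (fst z * \<theta>) (snd z)))"
  proof (intro continuous_intros)
    have "continuous_on (({0..} \<times> X) \<times> cbox 0 1) (\<lambda>(z, \<theta>). f (fst z * \<theta>) (snd z))"
      unfolding split_beta by (rule continuous_on_compose_pair[OF f]) (auto intro!: continuous_intros)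
    then show "continuous_on ({0..} \<times> X) (\<lambda>z. integral {0..1} (\<lambda>\<theta>. f (fst z * \<theta>) (snd z)))"
      using integral_continuous_on_param by fastforce
  qed
  show ?thesis
  proof (rule continuous_on_eq[OF cont])
    fix z :: "real \<times> 'a" assume z: "z \<in> {0..} \<times> X"
    have "continuous_on {0..fst z} (\<lambda>\<tau>. f \<tau> (snd z))"
      by (rule continuous_on_compose_pair[OF f]) (use z in \<open>auto intro!: continuous_intros\<close>)
    then show "fst z * integral {0..1} (\<lambda>\<theta>. f (fst z * \<theta>) (snd z)) = (\<lambda>(t, x). integral {0..t} (\<lambda>\<tau>. f \<tau> x)) z"
      using z integral_rescale[of "fst z" "\<lambda>\<tau>. f \<tau> (snd z)"] by (auto simp: split_beta)
  qed
qed

text \<open>Continuously differentiable solutions in the variables \<open>s = \<delta>\<^sub>+ + \<delta>\<^sub>-\<close>, \<open>d = \<delta>\<^sub>+ - \<delta>\<^sub>-\<close>; \<open>s'\<close> and \<open>d'\<close>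
  are the time derivatives. Derivatives in \<open>x\<close> are needed in the open interval only, since every
  integration in \<open>x\<close> uses continuity at the end points.\<close>

locale regular_solution =
  fixes L M \<kappa> :: real and s d s' d' :: "real \<Rightarrow> real \<Rightarrow> real"
  assumes L: "L > 0" and M: "M > 0" and ml_small: "M * L < 1 / 2" and \<kappa>: "\<kappa> > 0"
    and cont: "continuous_on ({0..} \<times> {0..L}) (\<lambda>(t, x). s t x)" "continuous_on ({0..} \<times> {0..L}) (\<lambda>(t, x). d t x)"
      "continuous_on ({0..} \<times> {0..L}) (\<lambda>(t, x). s' t x)" "continuous_on ({0..} \<times> {0..L}) (\<lambda>(t, x). d' t x)"
    and s_t: "\<And>t x. 0 \<le> t \<Longrightarrow> x \<in> {0..L} \<Longrightarrow> ((\<lambda>t. s t x) has_real_derivative s' t x) (at t within {0..})"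
    and d_t: "\<And>t x. 0 \<le> t \<Longrightarrow> x \<in> {0..L} \<Longrightarrow> ((\<lambda>t. d t x) has_real_derivative d' t x) (at t within {0..})"
    and s_x: "\<And>t x. 0 \<le> t \<Longrightarrow> 0 < x \<Longrightarrow> x < L \<Longrightarrow> (s t has_real_derivative M * d t x - d' t x) (at x)"
    and d_x: "\<And>t x. 0 \<le> t \<Longrightarrow> 0 < x \<Longrightarrow> x < L \<Longrightarrow> (d t has_real_derivative - (s' t x + M * s t x)) (at x)"
    and d_L: "\<And>t. 0 \<le> t \<Longrightarrow> d t L = 0" and d_0: "\<And>t. 0 \<le> t \<Longrightarrow> d t 0 = - \<kappa> * s t 0"
begin

definition "mass t = integral {0..L} (\<lambda>x. (s t x)\<^sup>2 + (d t x)\<^sup>2)"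

lemma joint_cont_compose:
  assumes "continuous_on ({0..} \<times> {0..L}) (\<lambda>(t, x). f t x)"
    and "continuous_on A g" "continuous_on A h" "\<And>z. z \<in> A \<Longrightarrow> 0 \<le> g z" "\<And>z. z \<in> A \<Longrightarrow> 0 \<le> h z \<and> h z \<le> L"
  shows "continuous_on A (\<lambda>z. f (g z) (h z) :: real)"
  by (rule continuous_on_compose_pair[OF assms(1)]) (use assms in auto)

lemma slice_cont:
  assumes "continuous_on ({0..} \<times> {0..L}) (\<lambda>(t, x). f t x)" "0 \<le> t"
  shows "continuous_on {0..L} (f t :: real \<Rightarrow> real)"
  by (rule continuous_on_compose_pair[OF assms(1)]) (use assms(2) in auto)

lemmas [continuous_intros] = cont[THEN joint_cont_compose]

text \<open>Take the potential at time \<open>0\<close> and add the time integrals of \<open>s\<close> and \<open>d\<close>. The equations in \<open>x\<close> persist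
  because their derivatives in \<open>t\<close> are exactly the equations satisfied by \<open>(s, d)\<close>.\<close>

lemma potential_evolution:
  obtains S D where
    "continuous_on ({0..} \<times> {0..L}) (\<lambda>(t, x). S t x)" "continuous_on ({0..} \<times> {0..L}) (\<lambda>(t, x). D t x)"
    "\<And>t. 0 \<le> t \<Longrightarrow> stationary_potential L M \<kappa> (s t) (d t) (S t) (D t)"
    "\<And>t x. 0 \<le> t \<Longrightarrow> x \<in> {0..L} \<Longrightarrow> ((\<lambda>t. S t x) has_real_derivative s t x) (at t within {0..})"
    "\<And>t x. 0 \<le> t \<Longrightarrow> x \<in> {0..L} \<Longrightarrow> ((\<lambda>t. D t x) has_real_derivative d t x) (at t within {0..})"
proof -
  have "continuous_on {0..L} (s 0)" "continuous_on {0..L} (d 0)"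
    by (rule slice_cont[OF cont(1)], simp) (rule slice_cont[OF cont(2)], simp)
  then obtain S\<^sub>0 D\<^sub>0 where "stationary_potential L M \<kappa> (s 0) (d 0) S\<^sub>0 D\<^sub>0"
    using stationary_potential_exists[OF L M ml_small \<kappa>] by blast
  then interpret P0: stationary_potential L M \<kappa> "s 0" "d 0" S\<^sub>0 D\<^sub>0 .
  define S where "S t x = S\<^sub>0 x + integral {0..t} (\<lambda>\<tau>. s \<tau> x)" for t x
  define D where "D t x = D\<^sub>0 x + integral {0..t} (\<lambda>\<tau>. d \<tau> x)" for t x
  have time_deriv: "((\<lambda>t. c + integral {0..t} g) has_real_derivative g t) (at t within {0..})"
    if g: "continuous_on {0..} g" and t: "0 \<le> t" for g t and c :: real
  proof -
    have "((\<lambda>t. integral {0..t} g) has_real_derivative g t) (at t within {0..t + 1})"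
      by (rule integral_has_real_derivative) (use t in \<open>auto intro: continuous_on_subset[OF g]\<close>)
    moreover have "at t within {0..t + 1} = at t within {0..}"
      by (rule at_within_nhd[of _ "{..<t + 1}"]) auto
    ultimately show ?thesis by (auto intro!: derivative_eq_intros)
  qed
  have St: "((\<lambda>t. S t x) has_real_derivative s t x) (at t within {0..})"
    and Dt: "((\<lambda>t. D t x) has_real_derivative d t x) (at t within {0..})" if "0 \<le> t" "x \<in> {0..L}" for t x
    unfolding S_def D_def using that by (intro time_deriv; auto intro!: continuous_intros)+
  have initial: "continuous_on ({0..} \<times> {0..L}) (\<lambda>z. f (snd z))" if "continuous_on {0..L} f" for f :: "real \<Rightarrow> real"
    by (rule continuous_on_compose2[OF that]) (auto intro!: continuous_intros)
  have Sc: "continuous_on ({0..} \<times> {0..L}) (\<lambda>(t, x). S t x)"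
    and Dc: "continuous_on ({0..} \<times> {0..L}) (\<lambda>(t, x). D t x)"
    unfolding S_def D_def split_beta
    by (intro continuous_on_add initial P0.cont
      continuous_on_time_integral[OF cont(1), unfolded split_beta]
      continuous_on_time_integral[OF cont(2), unfolded split_beta])+
  have FTC: "integral {0..t} (\<lambda>\<tau>. g' \<tau> x) = g t x - g 0 x"
    if "0 \<le> t" "x \<in> {0..L}"
      and "\<And>t x. 0 \<le> t \<Longrightarrow> x \<in> {0..L} \<Longrightarrow> ((\<lambda>t. g t x) has_real_derivative g' t x) (at t within {0..})"
    for t x and g g' :: "real \<Rightarrow> real \<Rightarrow> real"
  proof (rule integral_unique, rule fundamental_theorem_of_calculus)
    fix \<tau> assume "\<tau> \<in> {0..t}"
    then have "((\<lambda>t. g t x) has_real_derivative g' \<tau> x) (at \<tau> within {0..t})"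
      by (intro has_field_derivative_subset[OF that(3)]) (use that(2) in auto)
    then show "((\<lambda>t. g t x) has_vector_derivative g' \<tau> x) (at \<tau> within {0..t})"
      by (simp add: has_real_derivative_iff_has_vector_derivative)
  qed (rule that(1))
  have space_deriv: "((\<lambda>x. integral {0..t} (\<lambda>\<tau>. g \<tau> x)) has_real_derivative integral {0..t} (\<lambda>\<tau>. g' \<tau> x)) (at x)"
    if t: "0 \<le> t" and x: "0 < x" "x < L"
      and g: "continuous_on ({0..} \<times> {0..L}) (\<lambda>(t, x). g t x)" and g': "continuous_on ({0..} \<times> {0..L}) (\<lambda>(t, x). g' t x)"
      and deriv: "\<And>t x. 0 \<le> t \<Longrightarrow> 0 < x \<Longrightarrow> x < L \<Longrightarrow> (g t has_real_derivative g' t x) (at x)"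
    for t x and g g' :: "real \<Rightarrow> real \<Rightarrow> real"
  proof -
    have "((\<lambda>x. integral (cbox 0 t) (\<lambda>\<tau>. g \<tau> x)) has_real_derivative integral (cbox 0 t) (\<lambda>\<tau>. g' \<tau> x)) (at x within {0<..<L})"
    proof (rule leibniz_rule_field_derivative[where U="{0<..<L}"])
      show "((\<lambda>x. g \<tau> x) has_real_derivative g' \<tau> x) (at x within {0<..<L})"
        if "x \<in> {0<..<L}" "\<tau> \<in> cbox 0 t" for x \<tau>
        using deriv[of \<tau> x] that by (auto intro: has_field_derivative_at_within)
      show "(\<lambda>\<tau>. g \<tau> x) integrable_on cbox 0 t" if "x \<in> {0<..<L}" for x
        using that by (auto intro!: integrable_continuous_real joint_cont_compose[OF g] continuous_intros)
      show "continuous_on ({0<..<L} \<times> cbox 0 t) (\<lambda>(x, \<tau>). g' \<tau> x)"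
        unfolding split_beta by (auto intro!: joint_cont_compose[OF g'] continuous_intros)
    qed (use x in auto)
    moreover have "at x within {0<..<L} = at x"
      by (rule at_within_open) (use x in auto)
    ultimately show ?thesis by simp
  qed
  have int: "(\<lambda>\<tau>. g \<tau> x) integrable_on {0..t}"
    if "continuous_on ({0..} \<times> {0..L}) (\<lambda>(t, x). g t x)" "x \<in> {0..L}" for g :: "real \<Rightarrow> real \<Rightarrow> real" and t x
    using that(2) by (auto intro!: integrable_continuous_real joint_cont_compose[OF that(1)] continuous_intros)
  have pot: "stationary_potential L M \<kappa> (s t) (d t) (S t) (D t)" if t: "0 \<le> t" for t
  proof
    show "continuous_on {0..L} (s t)" "continuous_on {0..L} (d t)"
      "continuous_on {0..L} (S t)" "continuous_on {0..L} (D t)"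
      by (rule slice_cont[OF cont(1) t] slice_cont[OF cont(2) t] slice_cont[OF Sc t] slice_cont[OF Dc t])+
    fix x assume x: "0 < x" "x < L"
    then have x': "x \<in> {0..L}" by simp
    have incr: "integral {0..t} (\<lambda>\<tau>. d' \<tau> x) = d t x - d 0 x" "integral {0..t} (\<lambda>\<tau>. s' \<tau> x) = s t x - s 0 x"
      using t x' d_t s_t by (auto intro!: FTC)
    have "((\<lambda>x. integral {0..t} (\<lambda>\<tau>. s \<tau> x)) has_real_derivative integral {0..t} (\<lambda>\<tau>. M * d \<tau> x - d' \<tau> x)) (at x)"
      by (rule space_deriv[OF t x cont(1) _ s_x]) (auto simp: split_beta intro!: continuous_intros)
    also have "integral {0..t} (\<lambda>\<tau>. M * d \<tau> x - d' \<tau> x) = M * (D t x - D\<^sub>0 x) - (d t x - d 0 x)"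
      using incr int[OF cont(2) x', of t] int[OF cont(4) x', of t]
      by (subst Henstock_Kurzweil_Integration.integral_diff) (auto simp: D_def integrable_on_mult_right)
    finally show "(S t has_real_derivative M * D t x - d t x) (at x)"
      unfolding S_def[abs_def] using P0.S_x[OF x] by (auto intro!: derivative_eq_intros simp: algebra_simps)
    have "((\<lambda>x. integral {0..t} (\<lambda>\<tau>. d \<tau> x)) has_real_derivative integral {0..t} (\<lambda>\<tau>. - (s' \<tau> x + M * s \<tau> x))) (at x)"
      by (rule space_deriv[OF t x cont(2) _ d_x]) (auto simp: split_beta intro!: continuous_intros)
    also have "integral {0..t} (\<lambda>\<tau>. - (s' \<tau> x + M * s \<tau> x)) = - ((s t x - s 0 x) + M * (S t x - S\<^sub>0 x))"
      using incr int[OF cont(1) x', of t] int[OF cont(3) x', of t]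
      by (subst integral_neg, subst Henstock_Kurzweil_Integration.integral_add) (auto simp: S_def integrable_on_mult_right)
    finally show "(D t has_real_derivative - (s t x + M * S t x)) (at x)"
      unfolding D_def[abs_def] using P0.D_x[OF x] by (auto intro!: derivative_eq_intros simp: algebra_simps)
  next
    have "integral {0..t} (\<lambda>\<tau>. d \<tau> L) = integral {0..t} (\<lambda>\<tau>. 0)"
      by (rule integral_cong) (simp add: d_L)
    then show "D t L = 0" by (simp add: D_def P0.D_L)
    have "integral {0..t} (\<lambda>\<tau>. d \<tau> 0) = integral {0..t} (\<lambda>\<tau>. - \<kappa> * s \<tau> 0)"
      by (rule integral_cong) (simp add: d_0)
    then show "D t 0 = - \<kappa> * S t 0" by (simp add: D_def S_def P0.D_0 algebra_simps)
  qed (use L M ml_small \<kappa> in auto)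
  from that[OF Sc Dc pot St Dt] show ?thesis .
qed

text \<open>The functional is the energy plus \<open>\<epsilon>\<close> times \<open>\<integral> 2 (L - x) s d\<close>. Under the equations the time derivative of its
  density, increased by \<open>\<epsilon> (s\<^sup>2 + d\<^sup>2)\<close>, is an exact \<open>x\<close>-derivative: all zeroth order
  terms cancel. What remains are boundary terms at \<open>x = 0\<close>, which the boundary condition turns into
  multiples of \<open>s(0)\<^sup>2\<close> and of \<open>S(0) s(0)\<close>; the latter cancels against the derivative of
  \<open>\<kappa> M / 2 S(0)\<^sup>2\<close>.\<close>

lemma lyapunov_functional:
  fixes \<epsilon> :: real
  obtains V where
    "\<And>t. 0 \<le> t \<Longrightarrow> (V has_real_derivative - (\<kappa> - \<epsilon> * L * (1 + \<kappa>\<^sup>2)) * (s t 0)\<^sup>2 - \<epsilon> * mass t) (at t within {0..})"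
    "\<And>t. 0 \<le> t \<Longrightarrow> V t \<le> (2 + \<bar>\<epsilon>\<bar> * L) * mass t"
    "\<And>t. 0 \<le> t \<Longrightarrow> mass t \<le> 8 / 3 * (4 + 1 / \<kappa>\<^sup>2) * (V t + \<bar>\<epsilon>\<bar> * L * mass t)"
proof -
  obtain S D where SD: "continuous_on ({0..} \<times> {0..L}) (\<lambda>(t, x). S t x)" "continuous_on ({0..} \<times> {0..L}) (\<lambda>(t, x). D t x)"
    and pot: "\<And>t. 0 \<le> t \<Longrightarrow> stationary_potential L M \<kappa> (s t) (d t) (S t) (D t)"
    and S_t: "\<And>t x. 0 \<le> t \<Longrightarrow> x \<in> {0..L} \<Longrightarrow> ((\<lambda>t. S t x) has_real_derivative s t x) (at t within {0..})"
    and D_t: "\<And>t x. 0 \<le> t \<Longrightarrow> x \<in> {0..L} \<Longrightarrow> ((\<lambda>t. D t x) has_real_derivative d t x) (at t within {0..})"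
    by (rule potential_evolution) blast
  note [continuous_intros] = SD[THEN joint_cont_compose]
  define e1 where "e1 t x = ((d t x)\<^sup>2 + (s t x + M * S t x)\<^sup>2 - M\<^sup>2 * (D t x)\<^sup>2) / 2" for t x
  define e2 where "e2 t x = 2 * (L - x) * (s t x * d t x)" for t x
  define e' where "e' t x = d t x * d' t x + (s t x + M * S t x) * (s' t x + M * s t x) - M\<^sup>2 * (D t x * d t x)
      + \<epsilon> * (2 * (L - x) * (s' t x * d t x + s t x * d' t x))" for t x
  \<comment> \<open>the flux: at \<open>x = L\<close> it vanishes because \<open>d\<close> and \<open>L - x\<close> do\<close>
  define W where "W t x = - (s t x * d t x) - M * (S t x * d t x) - \<epsilon> * ((L - x) * ((s t x)\<^sup>2 + (d t x)\<^sup>2))" for t x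
  define V where "V t = integral {0..L} (\<lambda>x. e1 t x + \<epsilon> * e2 t x) + \<kappa> * M / 2 * (S t 0)\<^sup>2" for t
  have ec: "continuous_on {0..L} (e1 t)" "continuous_on {0..L} (e2 t)" "continuous_on {0..L} (e' t)"
     "continuous_on {0..L} (\<lambda>x. (s t x)\<^sup>2 + (d t x)\<^sup>2)" if "0 \<le> t" for t
    unfolding e1_def e2_def e'_def using that by (auto intro!: continuous_intros)
  have flux: "integral {0..L} (e' t) = - \<kappa> * (s t 0)\<^sup>2 - \<kappa> * M * (S t 0 * s t 0) + \<epsilon> * L * (1 + \<kappa>\<^sup>2) * (s t 0)\<^sup>2 - \<epsilon> * mass t"
    if t: "0 \<le> t" for t
  proof -
    interpret P: stationary_potential L M \<kappa> "s t" "d t" "S t" "D t" by (rule pot[OF t])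
    have "((\<lambda>x. e' t x + \<epsilon> * ((s t x)\<^sup>2 + (d t x)\<^sup>2)) has_integral W t L - W t 0) {0..L}"
    proof (rule fundamental_theorem_of_calculus_interior)
      show "continuous_on {0..L} (W t)" unfolding W_def using t by (auto intro!: continuous_intros)
      fix x assume "x \<in> {0<..<L}"
      then have x: "0 < x" "x < L" by auto
      have "(W t has_real_derivative e' t x + \<epsilon> * ((s t x)\<^sup>2 + (d t x)\<^sup>2)) (at x)"
        unfolding W_def
        by (rule derivative_eq_intros refl s_x[OF t x] d_x[OF t x] P.S_x[OF x])+
          (simp add: e'_def power2_eq_square algebra_simps)
      then show "(W t has_vector_derivative e' t x + \<epsilon> * ((s t x)\<^sup>2 + (d t x)\<^sup>2)) (at x)"
        by (simp add: has_real_derivative_iff_has_vector_derivative)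
    qed (use L in simp)
    then have "integral {0..L} (\<lambda>x. e' t x + \<epsilon> * ((s t x)\<^sup>2 + (d t x)\<^sup>2)) = W t L - W t 0"
      by (rule integral_unique)
    moreover have "integral {0..L} (\<lambda>x. e' t x + \<epsilon> * ((s t x)\<^sup>2 + (d t x)\<^sup>2)) = integral {0..L} (e' t) + \<epsilon> * mass t"
      unfolding mass_def using ec[OF t]
      by (subst Henstock_Kurzweil_Integration.integral_add)
        (auto intro!: integrable_continuous_real continuous_intros)
    moreover have "W t L - W t 0 = - \<kappa> * (s t 0)\<^sup>2 - \<kappa> * M * (S t 0 * s t 0) + \<epsilon> * L * (1 + \<kappa>\<^sup>2) * (s t 0)\<^sup>2"
      using d_L[OF t] d_0[OF t] by (simp add: W_def power2_eq_square algebra_simps)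
    ultimately show ?thesis by simp
  qed
  have "(V has_real_derivative - (\<kappa> - \<epsilon> * L * (1 + \<kappa>\<^sup>2)) * (s t 0)\<^sup>2 - \<epsilon> * mass t) (at t within {0..})"
    if t: "0 \<le> t" for t
  proof -
    have "((\<lambda>t. integral (cbox 0 L) (\<lambda>x. e1 t x + \<epsilon> * e2 t x)) has_real_derivative integral (cbox 0 L) (e' t)) (at t within {0..})"
    proof (rule leibniz_rule_field_derivative)
      fix t x :: real assume "t \<in> {0..}" "x \<in> cbox 0 L"
      then have tx: "0 \<le> t" "x \<in> {0..L}" by auto
      show "((\<lambda>t. e1 t x + \<epsilon> * e2 t x) has_real_derivative e' t x) (at t within {0..})"
        unfolding e1_def e2_def
        by (rule derivative_eq_intros refl s_t[OF tx] d_t[OF tx] S_t[OF tx] D_t[OF tx] | simp)+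
          (simp add: e'_def power2_eq_square field_simps)
    next
      show "(\<lambda>x. e1 t x + \<epsilon> * e2 t x) integrable_on cbox 0 L" if "t \<in> {0..}" for t
        using ec[of t] that by (auto intro!: integrable_continuous_real continuous_intros)
      show "continuous_on ({0..} \<times> cbox 0 L) (\<lambda>(t, x). e' t x)"
        unfolding split_beta e'_def by (auto intro!: continuous_intros)
    qed (use t in auto)
    then show ?thesis
      unfolding V_def using S_t[OF t, of 0] L
      by (auto intro!: derivative_eq_intros simp: flux[OF t] algebra_simps)
  qed
  moreover have "V t \<le> (2 + \<bar>\<epsilon>\<bar> * L) * mass t"
    and "mass t \<le> 8 / 3 * (4 + 1 / \<kappa>\<^sup>2) * (V t + \<bar>\<epsilon>\<bar> * L * mass t)" if t: "0 \<le> t" for t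
  proof -
    interpret P: stationary_potential L M \<kappa> "s t" "d t" "S t" "D t" by (rule pot[OF t])
    have m: "P.mass = mass t" by (simp add: P.mass_def mass_def)
    have V: "V t = P.energy + \<epsilon> * integral {0..L} (e2 t)"
      unfolding V_def P.energy_def e1_def[symmetric]
      using ec[OF t] by (subst Henstock_Kurzweil_Integration.integral_add)
        (auto intro!: integrable_continuous_real continuous_intros)
    have "norm (integral {0..L} (e2 t)) \<le> integral {0..L} (\<lambda>x. L * ((s t x)\<^sup>2 + (d t x)\<^sup>2))"
    proof (rule integral_norm_bound_integral)
      fix x assume x: "x \<in> {0..L}"
      have "2 * \<bar>s t x * d t x\<bar> \<le> (s t x)\<^sup>2 + (d t x)\<^sup>2"
        using sum_squares_bound[of "s t x" "d t x"] sum_squares_bound[of "s t x" "- d t x"] by (simp add: abs_le_iff abs_if)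
      then have "(L - x) * (2 * \<bar>s t x * d t x\<bar>) \<le> L * ((s t x)\<^sup>2 + (d t x)\<^sup>2)"
        using x by (intro mult_mono) auto
      moreover have "norm (e2 t x) = (L - x) * (2 * \<bar>s t x * d t x\<bar>)"
        using x by (simp add: e2_def abs_mult)
      ultimately show "norm (e2 t x) \<le> L * ((s t x)\<^sup>2 + (d t x)\<^sup>2)" by simp
    qed (use ec[OF t] in \<open>auto intro!: integrable_continuous_real continuous_intros\<close>)
    also have "\<dots> = L * mass t" by (simp add: mass_def)
    finally have "\<bar>\<epsilon> * integral {0..L} (e2 t)\<bar> \<le> \<bar>\<epsilon>\<bar> * L * mass t"
      by (simp add: abs_mult mult_left_mono mult.assoc)
    then have err: "V t - P.energy \<le> \<bar>\<epsilon>\<bar> * L * mass t" "P.energy \<le> V t + \<bar>\<epsilon>\<bar> * L * mass t"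
      unfolding V by (auto simp: abs_le_iff)
    show "V t \<le> (2 + \<bar>\<epsilon>\<bar> * L) * mass t"
      using P.energy_le_mass err(1) by (simp add: m algebra_simps)
    have "mass t \<le> 8 / 3 * (4 + 1 / \<kappa>\<^sup>2) * P.energy" using P.mass_le_energy m by simp
    also have "\<dots> \<le> 8 / 3 * (4 + 1 / \<kappa>\<^sup>2) * (V t + \<bar>\<epsilon>\<bar> * L * mass t)"
      using err(2) by (intro mult_left_mono) auto
    finally show "mass t \<le> 8 / 3 * (4 + 1 / \<kappa>\<^sup>2) * (V t + \<bar>\<epsilon>\<bar> * L * mass t)" .
  qed
  ultimately show thesis by (rule that)
qed

end

lemma exponential_decay_of_inequality:
  fixes V :: "real \<Rightarrow> real"
  assumes V: "\<And>t. 0 \<le> t \<Longrightarrow> (V has_real_derivative V' t) (at t within {0..})"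
    and le: "\<And>t. 0 \<le> t \<Longrightarrow> V' t \<le> - c * V t" and "0 \<le> t"
  shows "V t \<le> exp (- c * t) * V 0"
proof -
  have deriv: "((\<lambda>t. exp (c * t) * V t) has_real_derivative exp (c * t) * (V' t + c * V t)) (at t within {0..})"
    if "0 \<le> t" for t
    using V[OF that] by (auto intro!: derivative_eq_intros simp: algebra_simps)
  have "exp (c * t) * V t \<le> exp (c * 0) * V 0"
  proof (cases "t = 0")
    case False
    show ?thesis
    proof (rule DERIV_nonpos_imp_decreasing_open[where f="\<lambda>t. exp (c * t) * V t"])
      show "0 \<le> t" by fact
      fix x assume x: "0 < x" "x < t"
      have "at x within {0..} = at x"
        by (rule at_within_interior) (use x in simp)
      then have "((\<lambda>t. exp (c * t) * V t) has_real_derivative exp (c * x) * (V' x + c * V x)) (at x)"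
        using deriv[of x] x by simp
      moreover have "exp (c * x) * (V' x + c * V x) \<le> 0"
        using le[of x] x by (intro mult_nonneg_nonpos) auto
      ultimately show "\<exists>y. ((\<lambda>t. exp (c * t) * V t) has_real_derivative y) (at x) \<and> y \<le> 0" by blast
    next
      have "continuous_on {0..} (\<lambda>t. exp (c * t) * V t)"
        by (rule DERIV_continuous_on[OF deriv]) simp
      then show "continuous_on {0..t} (\<lambda>t. exp (c * t) * V t)"
        by (rule continuous_on_subset) auto
    qed
  qed simp
  then show ?thesis by (simp add: exp_minus field_simps)
qed

text \<open>The parameter \<open>\<epsilon>\<close> of the Lyapunov functional is chosen so small that the boundary term at \<open>x = 0\<close> has the
  right sign and that the multiplier term takes away at most half of the lower bound for the energy.
  The constants depend on \<open>L\<close> and \<open>\<kappa>\<close> only.\<close>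

lemma regular_solution_decay:
  fixes L M \<kappa> :: real
  assumes "L > 0" "\<kappa> > 0"
  shows "\<exists>C>0. \<exists>c>0. \<forall>s d s' d'. regular_solution L M \<kappa> s d s' d' \<longrightarrow>
    (\<forall>t\<ge>0. regular_solution.mass L s d t \<le> C * exp (- c * t) * regular_solution.mass L s d 0)"
proof -
  define C\<^sub>1 where "C\<^sub>1 = 8 / 3 * (4 + 1 / \<kappa>\<^sup>2)"
  have C1: "C\<^sub>1 > 0" unfolding C\<^sub>1_def by (intro mult_pos_pos add_pos_nonneg) auto
  define \<epsilon> where "\<epsilon> = min (1 / (2 * C\<^sub>1 * L)) (\<kappa> / (L * (1 + \<kappa>\<^sup>2)))"
  have pos: "1 + \<kappa>\<^sup>2 > 0" by (rule add_pos_nonneg) auto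
  have \<epsilon>: "\<epsilon> > 0" "C\<^sub>1 * \<epsilon> * L \<le> 1 / 2" "\<epsilon> * L * (1 + \<kappa>\<^sup>2) \<le> \<kappa>"
  proof -
    show "\<epsilon> > 0" using assms C1 pos by (simp add: \<epsilon>_def)
    have "\<epsilon> * (2 * C\<^sub>1 * L) \<le> 1"
      using C1 assms by (subst pos_le_divide_eq[symmetric]) (auto simp: \<epsilon>_def)
    then show "C\<^sub>1 * \<epsilon> * L \<le> 1 / 2" by (simp add: mult_ac)
    have "\<epsilon> * (L * (1 + \<kappa>\<^sup>2)) \<le> \<kappa>"
      using pos assms by (subst pos_le_divide_eq[symmetric]) (auto simp: \<epsilon>_def)
    then show "\<epsilon> * L * (1 + \<kappa>\<^sup>2) \<le> \<kappa>" by (simp add: mult_ac)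
  qed
  define b where "b = 2 + \<epsilon> * L"
  have b: "b > 0" using \<epsilon>(1) assms by (simp add: b_def add_pos_pos)
  have "mass t \<le> 2 * C\<^sub>1 * b * exp (- (\<epsilon> / b) * t) * mass 0"
    if "regular_solution L M \<kappa> s d s' d'" "0 \<le> t" and mass: "mass = regular_solution.mass L s d"
    for s d s' d' t mass
  proof -
    interpret regular_solution L M \<kappa> s d s' d' by fact
    note mass = mass[unfolded atomize_eq]
    obtain V where V: "\<And>t. 0 \<le> t \<Longrightarrow> (V has_real_derivative - (\<kappa> - \<epsilon> * L * (1 + \<kappa>\<^sup>2)) * (s t 0)\<^sup>2 - \<epsilon> * mass t) (at t within {0..})"
      and upper: "\<And>t. 0 \<le> t \<Longrightarrow> V t \<le> b * mass t"
      and lower: "\<And>t. 0 \<le> t \<Longrightarrow> mass t \<le> C\<^sub>1 * (V t + \<epsilon> * L * mass t)"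
      using lyapunov_functional[of \<epsilon>] \<epsilon>(1) unfolding C\<^sub>1_def b_def mass by auto
    have nonneg: "0 \<le> mass t" if "0 \<le> t" for t
      unfolding mass mass_def
      by (rule integral_nonneg) (use that in \<open>auto intro!: integrable_continuous_real continuous_intros\<close>)
    have "V t \<le> exp (- (\<epsilon> / b) * t) * V 0"
    proof (rule exponential_decay_of_inequality[OF V _ \<open>0 \<le> t\<close>])
      fix t :: real assume t: "0 \<le> t"
      have "\<epsilon> / b * V t \<le> \<epsilon> / b * (b * mass t)"
        using upper[OF t] \<epsilon>(1) b by (intro mult_left_mono) auto
      then have "\<epsilon> / b * V t \<le> \<epsilon> * mass t" using b by simp
      moreover have "0 \<le> (\<kappa> - \<epsilon> * L * (1 + \<kappa>\<^sup>2)) * (s t 0)\<^sup>2"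
        using \<epsilon>(3) by (intro mult_nonneg_nonneg) auto
      ultimately show "- (\<kappa> - \<epsilon> * L * (1 + \<kappa>\<^sup>2)) * (s t 0)\<^sup>2 - \<epsilon> * mass t \<le> - (\<epsilon> / b) * V t"
        unfolding mult_minus_left by linarith
    qed
    also have "\<dots> \<le> exp (- (\<epsilon> / b) * t) * (b * mass 0)"
      using upper[of 0] by (intro mult_left_mono) auto
    finally have "V t \<le> exp (- (\<epsilon> / b) * t) * (b * mass 0)" .
    moreover have "mass t \<le> 2 * C\<^sub>1 * V t"
    proof -
      have "C\<^sub>1 * \<epsilon> * L * mass t \<le> 1 / 2 * mass t"
        using \<epsilon>(2) nonneg[OF \<open>0 \<le> t\<close>] by (rule mult_right_mono)
      then show ?thesis using lower[OF \<open>0 \<le> t\<close>] by (simp add: algebra_simps)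
    qed
    ultimately have "mass t \<le> 2 * C\<^sub>1 * (exp (- (\<epsilon> / b) * t) * (b * mass 0))"
      using C1 by (meson mult_left_mono order_trans less_imp_le mult_pos_pos zero_less_numeral)
    then show ?thesis by (simp add: mult_ac)
  qed
  then show ?thesis
    using C1 b \<epsilon>(1) by (intro exI[of _ "2 * C\<^sub>1 * b"] conjI exI[of _ "\<epsilon> / b"]) auto
qed

section \<open>Averaging in time\<close>

lemma integral_eq_UNIV:
  fixes f :: "'a::euclidean_space \<Rightarrow> real"
  assumes "\<And>x. x \<notin> T \<Longrightarrow> f x = 0"
  shows "integral T f = integral UNIV f"
proof -
  have "(\<lambda>x. if x \<in> T then f x else 0) = f" using assms by auto
  then show ?thesis using integral_restrict_UNIV[of T f] by simp
qed

text \<open>Averages of a function over times between \<open>t + 2 r\<close> and \<open>t + 4 r\<close>, with the weight given by a bump.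
  The integrals run over the larger window from \<open>r\<close> to \<open>5 r\<close>, which leaves room to shift the
  weight by up to \<open>r\<close> in either direction; since the window starts at a positive time, the averages are
  differentiable up to \<open>t = 0\<close>. The weight is not normalised.\<close>

locale time_averaging =
  fixes L r :: real
  assumes r: "r > 0"
begin

definition "weight \<tau> = bump r (\<tau> - 3 * r)"
definition "weight' \<tau> = bump_deriv r (\<tau> - 3 * r) (1::real)"

abbreviation "window \<equiv> {r..5 * r}"

definition "avg f t x = integral window (\<lambda>\<tau>. weight \<tau> * f (t + \<tau>) x)"
text \<open>The time derivative of the average, moved onto the weight by a shift of the time variable.\<close>

definition "avg' f t x = - integral window (\<lambda>\<tau>. weight' \<tau> * f (t + \<tau>) x)"

lemma weight_zero: "\<bar>s\<bar> \<le> r \<Longrightarrow> \<tau> \<notin> {r + s..5 * r + s} \<Longrightarrow> weight \<tau> = 0"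
  using r unfolding weight_def by (intro bump_zero) auto

lemma weight_deriv: "(weight has_real_derivative weight' \<tau>) (at \<tau> within X)"
proof -
  have 1: "((\<lambda>\<tau>. \<tau> - 3 * r) has_derivative (\<lambda>h. h)) (at \<tau> within X)"
    by (auto intro!: derivative_eq_intros)
  show ?thesis
    using has_derivative_compose[OF 1 bump_has_derivative[of r "\<tau> - 3 * r"]]
    unfolding has_field_derivative_def weight_def[abs_def] weight'_def
    by (rule has_derivative_eq_rhs) (simp add: bump_deriv_def fun_eq_iff)
qed

lemma weight_cont [continuous_intros]:
  "continuous_on A g \<Longrightarrow> continuous_on A (\<lambda>z. weight (g z))"
  "continuous_on A g \<Longrightarrow> continuous_on A (\<lambda>z. weight' (g z))"
  unfolding weight_def weight'_def by (intro continuous_intros; assumption)+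

lemma shift_window:
  assumes "\<bar>s\<bar> \<le> r"
  shows "integral window (\<lambda>\<tau>. weight (\<tau> + s) * h (\<tau> + s)) = integral window (\<lambda>\<tau>. weight \<tau> * h \<tau>)"
proof -
  have "integral window (\<lambda>\<tau>. weight (\<tau> + s) * h (\<tau> + s)) = integral {r + s..5 * r + s} (\<lambda>\<tau>. weight \<tau> * h \<tau>)"
    using integral_shift_Icc_real[of r "5 * r" "\<lambda>\<tau>. weight \<tau> * h \<tau>" s] by (simp add: o_def add.commute)
  also have "\<dots> = integral UNIV (\<lambda>\<tau>. weight \<tau> * h \<tau>)"
    using weight_zero[OF assms] by (intro integral_eq_UNIV) simp
  also have "\<dots> = integral window (\<lambda>\<tau>. weight \<tau> * h \<tau>)"
    using weight_zero[of 0] r by (intro integral_eq_UNIV[symmetric]) simp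
  finally show ?thesis .
qed

context
  fixes f :: "real \<Rightarrow> real \<Rightarrow> real"
  assumes f: "continuous_on ({0..} \<times> {0..L}) (\<lambda>(t, x). f t x)"
begin

lemma avg_cont:
  "continuous_on ({0..} \<times> {0..L}) (\<lambda>(t, x). avg f t x)"
  "continuous_on ({0..} \<times> {0..L}) (\<lambda>(t, x). avg' f t x)"
proof -
  have "continuous_on ({0..} \<times> {0..L}) (\<lambda>z. integral (cbox r (5 * r)) (\<lambda>\<tau>. w \<tau> * f (fst z + \<tau>) (snd z)))"
    if w: "continuous_on UNIV w" for w :: "real \<Rightarrow> real"
  proof (rule integral_continuous_on_param)
    show "continuous_on (({0..} \<times> {0..L}) \<times> cbox r (5 * r)) (\<lambda>(z, \<tau>). w \<tau> * f (fst z + \<tau>) (snd z))"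
      unfolding split_beta using r
      by (intro continuous_on_mult continuous_on_compose_pair[OF f] continuous_on_compose2[OF w])
        (auto intro!: continuous_intros)
  qed
  note * = this
  show
    "continuous_on ({0..} \<times> {0..L}) (\<lambda>(t, x). avg f t x)"
    "continuous_on ({0..} \<times> {0..L}) (\<lambda>(t, x). avg' f t x)"
    unfolding split_beta avg_def avg'_def cbox_interval
    by (intro *[unfolded cbox_interval] continuous_on_minus weight_cont continuous_on_id)+
qed

lemma avg_time_deriv:
  assumes t: "0 \<le> t" and x: "x \<in> {0..L}"
  shows "((\<lambda>t. avg f t x) has_real_derivative avg' f t x) (at t within {0..})"
proof -
  have *: "((\<lambda>u. integral (cbox r (5 * r)) (\<lambda>\<tau>. weight (\<tau> - (u - t)) * f (t + \<tau>) x)) has_real_derivative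
    integral (cbox r (5 * r)) (\<lambda>\<tau>. - weight' (\<tau> - (t - t)) * f (t + \<tau>) x)) (at t within {0..})"
  proof (rule leibniz_rule_field_derivative[where fx="\<lambda>u \<tau>. - weight' (\<tau> - (u - t)) * f (t + \<tau>) x"])
    show "((\<lambda>u. weight (\<tau> - (u - t)) * f (t + \<tau>) x) has_real_derivative - weight' (\<tau> - (u - t)) * f (t + \<tau>) x) (at u within {0..})"
      for u \<tau>
    proof -
      have "((\<lambda>u. weight (\<tau> - (u - t))) has_real_derivative weight' (\<tau> - (u - t)) * (- 1)) (at u within {0..})"
        by (rule DERIV_chain2[OF weight_deriv]) (auto intro!: derivative_eq_intros)
      then show ?thesis by (auto intro!: derivative_eq_intros)
    qed
    show "(\<lambda>\<tau>. weight (\<tau> - (u - t)) * f (t + \<tau>) x) integrable_on cbox r (5 * r)" for u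
      unfolding cbox_interval
      by (intro integrable_continuous_real continuous_on_mult continuous_on_compose_pair[OF f])
        (use t x r in \<open>auto intro!: continuous_intros\<close>)
    show "continuous_on ({0..} \<times> cbox r (5 * r)) (\<lambda>(u, \<tau>). - weight' (\<tau> - (u - t)) * f (t + \<tau>) x)"
      unfolding split_beta
      by (intro continuous_on_mult continuous_on_compose_pair[OF f])
        (use t x r in \<open>auto intro!: continuous_intros\<close>)
  qed (use t in auto)
  have eq: "integral window (\<lambda>\<tau>. weight (\<tau> - (u - t)) * f (t + \<tau>) x) = avg f u x" if "dist u t < r" for u
    using shift_window[of "- (u - t)" "\<lambda>\<tau>. f (u + \<tau>) x"] that
    by (simp add: avg_def dist_real_def algebra_simps)
  show ?thesis
  proof (rule has_field_derivative_transform_within[OF _ r])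
    show "((\<lambda>u. integral window (\<lambda>\<tau>. weight (\<tau> - (u - t)) * f (t + \<tau>) x)) has_real_derivative avg' f t x) (at t within {0..})"
      using * by (simp add: avg'_def cbox_interval)
  qed (use t in \<open>auto simp: eq\<close>)
qed

lemma avg_approx:
  assumes t: "0 \<le> t"
    and close: "\<And>\<tau> x. \<tau> \<in> {2 * r..4 * r} \<Longrightarrow> x \<in> {0..L} \<Longrightarrow> \<bar>f (t + \<tau>) x - f t x\<bar> \<le> \<eta>"
    and x: "x \<in> {0..L}"
  shows "\<bar>avg f t x / integral window weight - f t x\<bar> \<le> \<eta>"
proof -
  have w: "bump r (3 * r - \<tau>) = weight \<tau>" for \<tau>
    using bump_uminus[of r "\<tau> - 3 * r"] by (simp add: weight_def)
  have J: "integral window weight > 0"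
    using mollifier_mass_pos[of "3 * r" r "5 * r" r] r by (simp add: w)
  have "\<bar>avg f t x - f t x * integral window weight\<bar> \<le> \<eta> * integral window weight"
  proof -
    have "continuous_on window (\<lambda>\<tau>. f (t + \<tau>) x)"
      by (rule continuous_on_compose_pair[OF f]) (use t x r in \<open>auto intro!: continuous_intros\<close>)
    then have "\<bar>integral window (\<lambda>\<tau>. f (t + \<tau>) x * weight \<tau>) - f t x * integral window weight\<bar> \<le> \<eta> * integral window weight"
      by (rule mollifier_error[of r "5 * r" _ r "3 * r", unfolded w cbox_interval])
        (use r x in \<open>auto intro!: close\<close>)
    then show ?thesis by (simp add: avg_def mult.commute)
  qed
  moreover have "avg f t x / integral window weight - f t x = (avg f t x - f t x * integral window weight) / integral window weight"
    using J by (simp add: field_simps)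
  ultimately show ?thesis using J by (simp add: abs_divide field_simps)
qed

end

text \<open>Moving \<open>x\<close> by \<open>c s\<close> amounts to moving along the characteristic through \<open>(t, x)\<close> and shifting the weight
  back in time by \<open>s\<close>. Both are differentiable in \<open>s\<close>, the first by the equation and the second
  because the weight is. Thus the average is differentiable in \<open>x\<close> although \<open>f\<close> need not be.\<close>

lemma avg_space_deriv:
  fixes f g :: "real \<Rightarrow> real \<Rightarrow> real"
  assumes f: "continuous_on ({0..} \<times> {0..L}) (\<lambda>(t, x). f t x)" and g: "continuous_on ({0..} \<times> {0..L}) (\<lambda>(t, x). g t x)"
    and char: "\<And>t x. 0 < t \<Longrightarrow> 0 < x \<Longrightarrow> x < L \<Longrightarrow> ((\<lambda>s. f (t + s) (x + c * s)) has_real_derivative g t x) (at 0)"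
    and c: "c = 1 \<or> c = - 1" and t: "0 \<le> t" and x: "0 < x" "x < L"
  shows "(avg f t has_real_derivative c * (avg g t x - avg' f t x)) (at x)"
proof -
  define \<delta> where "\<delta> = min r (min x (L - x))"
  define U where "U = {-\<delta><..<\<delta>}"
  have \<delta>: "\<delta> > 0" using r x by (simp add: \<delta>_def)
  have U: "\<bar>s\<bar> < r" "0 < x + c * s" "x + c * s < L" if "s \<in> U" for s
    using that c by (auto simp: U_def \<delta>_def)
  have pos: "0 < t + \<tau> + s" if "s \<in> U" "\<tau> \<in> window" for s \<tau>
    using U(1)[OF that(1)] that(2) t by auto
  have char': "((\<lambda>s. f (t + \<tau> + s) (x + c * s)) has_real_derivative g (t + \<tau> + s) (x + c * s)) (at s)"
    if "s \<in> U" "\<tau> \<in> window" for s \<tau>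
  proof -
    have "((\<lambda>h. f (t + \<tau> + s + h) (x + c * s + c * h)) has_real_derivative g (t + \<tau> + s) (x + c * s)) (at 0)"
      by (rule char) (use pos[OF that] U[OF that(1)] in auto)
    then have "((\<lambda>h. f (t + \<tau> + (h + s)) (x + c * (h + s))) has_real_derivative g (t + \<tau> + s) (x + c * s)) (at 0)"
      by (simp add: algebra_simps)
    then show ?thesis
      using DERIV_shift[of "\<lambda>s. f (t + \<tau> + s) (x + c * s)" _ 0 s] by simp
  qed
  have *: "((\<lambda>s. integral (cbox r (5 * r)) (\<lambda>\<tau>. weight (\<tau> + s) * f (t + \<tau> + s) (x + c * s))) has_real_derivative
      integral (cbox r (5 * r)) (\<lambda>\<tau>. weight' (\<tau> + 0) * f (t + \<tau> + 0) (x + c * 0) + weight (\<tau> + 0) * g (t + \<tau> + 0) (x + c * 0))) (at 0 within U)"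
  proof (rule leibniz_rule_field_derivative[where fx="\<lambda>s \<tau>. weight' (\<tau> + s) * f (t + \<tau> + s) (x + c * s) + weight (\<tau> + s) * g (t + \<tau> + s) (x + c * s)"])
    fix s \<tau> assume s: "s \<in> U" and "\<tau> \<in> cbox r (5 * r)"
    then have \<tau>: "\<tau> \<in> window" by simp
    have "((\<lambda>s. weight (\<tau> + s)) has_real_derivative weight' (\<tau> + s) * 1) (at s within U)"
      by (rule DERIV_chain2[OF weight_deriv]) (auto intro!: derivative_eq_intros)
    with has_field_derivative_at_within[OF char'[OF s \<tau>], of U]
    show "((\<lambda>s. weight (\<tau> + s) * f (t + \<tau> + s) (x + c * s)) has_real_derivative
        weight' (\<tau> + s) * f (t + \<tau> + s) (x + c * s) + weight (\<tau> + s) * g (t + \<tau> + s) (x + c * s)) (at s within U)"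
      by (auto intro!: derivative_eq_intros)
  next
    fix s assume s: "s \<in> U"
    show "(\<lambda>\<tau>. weight (\<tau> + s) * f (t + \<tau> + s) (x + c * s)) integrable_on cbox r (5 * r)"
      unfolding cbox_interval
      by (intro integrable_continuous_real continuous_on_mult continuous_on_compose_pair[OF f])
        (use U[OF s] pos[OF s] in \<open>auto intro!: continuous_intros simp: less_imp_le\<close>)
  next
    show "continuous_on (U \<times> cbox r (5 * r)) (\<lambda>(s, \<tau>). weight' (\<tau> + s) * f (t + \<tau> + s) (x + c * s) + weight (\<tau> + s) * g (t + \<tau> + s) (x + c * s))"
      unfolding split_beta cbox_interval
      by (intro continuous_on_add continuous_on_mult continuous_on_compose_pair[OF f] continuous_on_compose_pair[OF g])
        (use U pos in \<open>auto intro!: continuous_intros simp: less_imp_le\<close>)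
  qed (use \<delta> in \<open>auto simp: U_def\<close>)
  have at: "at 0 within U = at 0"
    by (rule at_within_open) (use \<delta> in \<open>auto simp: U_def\<close>)
  have shift: "integral window (\<lambda>\<tau>. weight (\<tau> + s) * f (t + \<tau> + s) (x + c * s)) = avg f t (x + c * s)" if "s \<in> U" for s
    using shift_window[of s "\<lambda>\<tau>. f (t + \<tau>) (x + c * s)"] U(1)[OF that] by (simp add: avg_def add.assoc)
  have window_value: "integral window (\<lambda>\<tau>. weight' \<tau> * f (t + \<tau>) x + weight \<tau> * g (t + \<tau>) x) = avg g t x - avg' f t x"
    unfolding avg_def avg'_def
    by (subst Henstock_Kurzweil_Integration.integral_add)
      (use t x r in \<open>auto intro!: integrable_continuous_real continuous_intros continuous_on_compose_pair[OF f] continuous_on_compose_pair[OF g]\<close>)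
  have "((\<lambda>s. avg f t (x + c * s)) has_real_derivative avg g t x - avg' f t x) (at 0)"
  proof (rule has_field_derivative_transform_within_open)
    show "((\<lambda>s. integral window (\<lambda>\<tau>. weight (\<tau> + s) * f (t + \<tau> + s) (x + c * s))) has_real_derivative avg g t x - avg' f t x) (at 0)"
      using * unfolding at cbox_interval by (simp only: add_0_right mult_zero_right window_value)
    show "open U" "0 \<in> U" using \<delta> by (auto simp: U_def)
  qed (rule shift)
  moreover have "((\<lambda>y. c * (y - x)) has_real_derivative c) (at x)"
    by (auto intro!: derivative_eq_intros)
  ultimately have "((\<lambda>y. avg f t (x + c * (c * (y - x)))) has_real_derivative (avg g t x - avg' f t x) * c) (at x)"
    by (intro DERIV_chain2[where f="\<lambda>s. avg f t (x + c * s)" and g="\<lambda>y. c * (y - x)"]) simp_all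
  moreover have "(\<lambda>y. avg f t (x + c * (c * (y - x)))) = avg f t"
    using c by auto
  ultimately show ?thesis by (simp add: mult.commute)
qed

end

section \<open>Decay of mild solutions\<close>

text \<open>The system is linear and autonomous and its boundary conditions do not involve derivatives, so
  averages in time are again solutions.\<close>

lemma mild_solution_averaged:
  assumes "L > 0" "M > 0" "M * L < 1 / 2" "\<bar>k\<bar> < 1" and r: "r > 0"
    and mild: "mild_solution L M k p m"
  shows "regular_solution L M ((1 - k) / (1 + k))
    (\<lambda>t x. time_averaging.avg r p t x + time_averaging.avg r m t x)
    (\<lambda>t x. time_averaging.avg r p t x - time_averaging.avg r m t x)
    (\<lambda>t x. time_averaging.avg' r p t x + time_averaging.avg' r m t x)
    (\<lambda>t x. time_averaging.avg' r p t x - time_averaging.avg' r m t x)"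
proof -
  interpret time_averaging L r by unfold_locales (rule r)
  have p: "continuous_on ({0..} \<times> {0..L}) (\<lambda>(t, x). p t x)"
    and m: "continuous_on ({0..} \<times> {0..L}) (\<lambda>(t, x). m t x)"
    and char: "\<And>t x. 0 < t \<Longrightarrow> 0 < x \<Longrightarrow> x < L \<Longrightarrow> ((\<lambda>s. p (t + s) (x + s)) has_real_derivative - (M * m t x)) (at 0)"
      "\<And>t x. 0 < t \<Longrightarrow> 0 < x \<Longrightarrow> x < L \<Longrightarrow> ((\<lambda>s. m (t + s) (x - s)) has_real_derivative - (M * p t x)) (at 0)"
    and bc: "\<And>t. 0 \<le> t \<Longrightarrow> p t 0 = k * m t 0" "\<And>t. 0 \<le> t \<Longrightarrow> m t L = p t L"
    using mild by (auto simp: mild_solution_def)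
  have scaled: "continuous_on ({0..} \<times> {0..L}) (\<lambda>(t, x). - (M * f t x))"
    if "continuous_on ({0..} \<times> {0..L}) (\<lambda>(t, x). f t x)" for f :: "real \<Rightarrow> real \<Rightarrow> real"
    using that unfolding split_beta by (intro continuous_intros)
  have avg_scaled: "avg (\<lambda>t x. - (M * f t x)) t x = - (M * avg f t x)" for f t x
  proof -
    have "(\<lambda>\<tau>. weight \<tau> * - (M * f (t + \<tau>) x)) = (\<lambda>\<tau>. - M * (weight \<tau> * f (t + \<tau>) x))"
      by auto
    then show ?thesis by (simp only: avg_def integral_mult_right)
  qed
  have px: "(avg p t has_real_derivative - (M * avg m t x) - avg' p t x) (at x)" if "0 \<le> t" "0 < x" "x < L" for t x
    using avg_space_deriv[OF p scaled[OF m], of 1 t x] char(1) that by (simp add: avg_scaled)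
  have mx: "(avg m t has_real_derivative M * avg p t x + avg' m t x) (at x)" if "0 \<le> t" "0 < x" "x < L" for t x
    using avg_space_deriv[OF m scaled[OF p], of "-1" t x] char(2) that by (simp add: avg_scaled add.commute)
  have bc': "avg p t 0 = k * avg m t 0" "avg m t L = avg p t L" if "0 \<le> t" for t
  proof -
    have "avg p t 0 = integral window (\<lambda>\<tau>. k * (weight \<tau> * m (t + \<tau>) 0))"
      unfolding avg_def by (rule integral_cong) (use bc(1) that r in auto)
    then show "avg p t 0 = k * avg m t 0" by (simp add: avg_def)
    show "avg m t L = avg p t L"
      unfolding avg_def by (rule integral_cong) (use bc(2) that r in auto)
  qed
  note cont = avg_cont[OF p, unfolded split_beta] avg_cont[OF m, unfolded split_beta]
  note time = avg_time_deriv[OF p] avg_time_deriv[OF m]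
  show ?thesis
  proof
    show "(1 - k) / (1 + k) > 0" using \<open>\<bar>k\<bar> < 1\<close> by auto
    show "avg p t 0 - avg m t 0 = - ((1 - k) / (1 + k)) * (avg p t 0 + avg m t 0)" if "0 \<le> t" for t
      using bc'(1)[OF that] \<open>\<bar>k\<bar> < 1\<close> by (simp add: field_simps)
    show "((\<lambda>x. avg p t x + avg m t x) has_real_derivative
      M * (avg p t x - avg m t x) - (avg' p t x - avg' m t x)) (at x)" if "0 \<le> t" "0 < x" "x < L" for t x
      by (rule DERIV_cong[OF DERIV_add[OF px[OF that] mx[OF that]]]) (simp add: algebra_simps)
    show "((\<lambda>x. avg p t x - avg m t x) has_real_derivative
      - (avg' p t x + avg' m t x + M * (avg p t x + avg m t x))) (at x)" if "0 \<le> t" "0 < x" "x < L" for t x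
      by (rule DERIV_cong[OF DERIV_diff[OF px[OF that] mx[OF that]]]) (simp add: algebra_simps)
  qed (use assms bc'(2) in \<open>auto simp: split_beta intro!: continuous_on_add continuous_on_diff cont DERIV_add DERIV_diff time\<close>)
qed

lemma uniform_limit_time_average:
  fixes f :: "real \<Rightarrow> real \<Rightarrow> real"
  assumes f: "continuous_on ({0..} \<times> {0..L}) (\<lambda>(t, x). f t x)" and t: "0 \<le> t"
    and r_pos: "\<And>n. r n > 0" and r_lim: "r \<longlonglongrightarrow> 0"
  shows "uniform_limit {0..L} (\<lambda>n x. time_averaging.avg (r n) f t x / integral {r n..5 * r n} (time_averaging.weight (r n)))
     (f t) sequentially"
proof (rule uniform_limitI)
  fix e :: real assume "e > 0"
  have "uniformly_continuous_on ({t..t + 1} \<times> {0..L}) (\<lambda>(t, x). f t x)"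
    using t by (intro compact_uniformly_continuous continuous_on_subset[OF f] compact_Times) auto
  then obtain d where d: "d > 0" "\<And>z z'. z \<in> {t..t + 1} \<times> {0..L} \<Longrightarrow> z' \<in> {t..t + 1} \<times> {0..L} \<Longrightarrow>
      dist z' z < d \<Longrightarrow> dist ((\<lambda>(t, x). f t x) z') ((\<lambda>(t, x). f t x) z) < e / 2"
    unfolding uniformly_continuous_on_def using \<open>e > 0\<close> half_gt_zero by metis
  have "\<forall>\<^sub>F n in sequentially. r n < min 1 d / 4"
    using d(1) by (intro order_tendstoD(2)[OF r_lim]) auto
  then show "\<forall>\<^sub>F n in sequentially. \<forall>x\<in>{0..L}.
      dist (time_averaging.avg (r n) f t x / integral {r n..5 * r n} (time_averaging.weight (r n))) (f t x) < e"
  proof eventually_elim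
    case (elim n)
    interpret time_averaging L "r n" by unfold_locales (rule r_pos)
    have close: "\<bar>f (t + \<tau>) x - f t x\<bar> \<le> e / 2" if "\<tau> \<in> {2 * r n..4 * r n}" "x \<in> {0..L}" for \<tau> x
      using d(2)[of "(t, x)" "(t + \<tau>, x)"] that elim r_pos[of n] by (auto simp: dist_Pair_Pair dist_real_def)
    show ?case
    proof
      fix x assume "x \<in> {0..L}"
      from avg_approx[OF f t close this]
      show "dist (avg f t x / integral window weight) (f t x) < e"
        using \<open>e > 0\<close> by (simp add: dist_real_def)
    qed
  qed
qed

text \<open>Divided by the mass \<open>J\<close> of the weight, the averages of a fixed solution converge uniformly in \<open>x\<close> at each
  fixed time. The constants in the decay estimate for the averages do not depend on the width, so the
  estimate survives the limit.\<close>

lemma mild_solution_decay: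
  assumes "L > 0" "M > 0" "M * L < 1 / 2" "\<bar>k\<bar> < 1"
  shows "\<exists>C>0. \<exists>c>0. \<forall>p m. mild_solution L M k p m \<longrightarrow>
    (\<forall>t\<ge>0. integral {0..L} (\<lambda>x. (p t x)\<^sup>2 + (m t x)\<^sup>2)
        \<le> C * exp (- c * t) * integral {0..L} (\<lambda>x. (p 0 x)\<^sup>2 + (m 0 x)\<^sup>2))"
proof -
  have "(1 - k) / (1 + k) > 0" using \<open>\<bar>k\<bar> < 1\<close> by auto
  from regular_solution_decay[OF \<open>L > 0\<close> this] obtain C c where "C > 0" "c > 0" and
    decay: "\<And>s d s' d' t. regular_solution L M ((1 - k) / (1 + k)) s d s' d' \<Longrightarrow> t \<ge> 0 \<Longrightarrow>
      regular_solution.mass L s d t \<le> C * exp (- c * t) * regular_solution.mass L s d 0"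
    by metis
  have "integral {0..L} (\<lambda>x. (p t x)\<^sup>2 + (m t x)\<^sup>2) \<le> C * exp (- c * t) * integral {0..L} (\<lambda>x. (p 0 x)\<^sup>2 + (m 0 x)\<^sup>2)"
    if mild: "mild_solution L M k p m" and t: "0 \<le> t" for p m t
  proof -
    define r where "r n = 1 / real (Suc n)" for n
    have r: "r n > 0" for n by (simp add: r_def)
    have r0: "r \<longlonglongrightarrow> 0"
      unfolding r_def by (rule LIMSEQ_Suc) (rule lim_const_over_n)
    define J where "J n = integral {r n..5 * r n} (time_averaging.weight (r n))" for n
    define P where "P n t x = time_averaging.avg (r n) p t x / J n" for n t x
    define N where "N n t x = time_averaging.avg (r n) m t x / J n" for n t x
    define E where "E n t = integral {0..L} (\<lambda>x. (P n t x)\<^sup>2 + (N n t x)\<^sup>2)" for n t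
    have p: "continuous_on ({0..} \<times> {0..L}) (\<lambda>(t, x). p t x)"
      and m: "continuous_on ({0..} \<times> {0..L}) (\<lambda>(t, x). m t x)"
      using mild by (auto simp: mild_solution_def)
    have step: "E n t \<le> C * exp (- c * t) * E n 0" for n
    proof -
      interpret time_averaging L "r n" by unfold_locales (rule r)
      interpret regular_solution L M "(1 - k) / (1 + k)"
        "\<lambda>t x. avg p t x + avg m t x" "\<lambda>t x. avg p t x - avg m t x"
        "\<lambda>t x. avg' p t x + avg' m t x" "\<lambda>t x. avg' p t x - avg' m t x"
        by (rule mild_solution_averaged[OF assms r mild])
      have E: "E n t = mass t / (2 * (J n)\<^sup>2)" for t
      proof -
        have "(\<lambda>x. (P n t x)\<^sup>2 + (N n t x)\<^sup>2) =
            (\<lambda>x. ((avg p t x + avg m t x)\<^sup>2 + (avg p t x - avg m t x)\<^sup>2) / (2 * (J n)\<^sup>2))"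
          by (auto simp: P_def N_def power_divide power2_sum power2_diff add_divide_distrib diff_divide_distrib)
        then show ?thesis by (simp add: E_def mass_def)
      qed
      have "mass t / (2 * (J n)\<^sup>2) \<le> C * exp (- c * t) * mass 0 / (2 * (J n)\<^sup>2)"
        by (rule divide_right_mono[OF decay[OF regular_solution_axioms t]]) simp
      then show ?thesis by (simp add: E)
    qed
    have lim: "(\<lambda>n. E n t) \<longlonglongrightarrow> integral {0..L} (\<lambda>x. (p t x)\<^sup>2 + (m t x)\<^sup>2)" if t: "0 \<le> t" for t
    proof -
      have sq: "uniform_limit {0..L} (\<lambda>n x. (F n x)\<^sup>2) (\<lambda>x. (f t x)\<^sup>2) sequentially"
        if "uniform_limit {0..L} F (f t) sequentially" and f: "continuous_on ({0..} \<times> {0..L}) (\<lambda>(t, x). f t x)"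
        for F :: "nat \<Rightarrow> real \<Rightarrow> real" and f :: "real \<Rightarrow> real \<Rightarrow> real"
      proof -
        have "continuous_on {0..L} (f t)"
          by (rule continuous_on_compose_pair[OF f]) (use t in auto)
        then have "bounded (f t ` {0..L})"
          by (intro compact_imp_bounded compact_continuous_image) auto
        then show ?thesis
          unfolding power2_eq_square by (intro uniform_lim_mult that)
      qed
      have "uniform_limit {0..L} (\<lambda>n x. (P n t x)\<^sup>2 + (N n t x)\<^sup>2) (\<lambda>x. (p t x)\<^sup>2 + (m t x)\<^sup>2) sequentially"
        unfolding P_def N_def J_def
        by (intro uniform_limit_add sq p m uniform_limit_time_average t r r0)
      moreover have "continuous_on {0..L} (\<lambda>x. (P n t x)\<^sup>2 + (N n t x)\<^sup>2)" for n
      proof -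
        interpret time_averaging L "r n" by unfold_locales (rule r)
        have "continuous_on {0..L} (avg p t)" "continuous_on {0..L} (avg m t)"
          by (rule continuous_on_compose_pair[OF avg_cont(1)[OF p]] continuous_on_compose_pair[OF avg_cont(1)[OF m]]; use t in auto)+
        then show ?thesis
          unfolding P_def N_def divide_inverse by (intro continuous_intros)
      qed
      ultimately obtain A B where AB: "\<And>n. ((\<lambda>x. (P n t x)\<^sup>2 + (N n t x)\<^sup>2) has_integral A n) {0..L}"
          "((\<lambda>x. (p t x)\<^sup>2 + (m t x)\<^sup>2) has_integral B) {0..L}" "A \<longlonglongrightarrow> B"
        by (rule uniform_limit_integral) auto
      then have "E n t = A n" for n unfolding E_def by (intro integral_unique)
      then show ?thesis using AB(3) integral_unique[OF AB(2)] by simp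
    qed
    show ?thesis
      by (rule LIMSEQ_le[OF lim[OF t] tendsto_mult[OF tendsto_const lim[OF order_refl]]]) (use step in auto)
  qed
  then show ?thesis using \<open>C > 0\<close> \<open>c > 0\<close> by blast
qed

section \<open>Existence of mild solutions\<close>

text \<open>A function transported to the right on \<open>[0, R]\<close>, fed back into the left end with the factor \<open>k\<close>, with a
  nonlocal term that couples \<open>y\<close> to its mirror image \<open>R - y\<close>. Integrating along the characteristic that ends in
  \<open>(t, y)\<close>, back over the length \<open>l = min t y\<close> to where it enters the domain, gives
  \<open>u(t, y) = A(y - l) - k A(R) + k u(t - l, R) - M \<integral> u(t - l + s, R - y + l - s) ds\<close>. Writing the initial and
  the feedback contributions in one formula avoids a case distinction: one of the two arguments
  \<open>y - l\<close> and \<open>t - l\<close> is \<open>0\<close>, and the compatibility condition \<open>A(0) = k A(R)\<close> cancels the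
  superfluous part. For \<open>w = exp(- \<gamma> t) u\<close> with \<open>\<gamma> = 2 M\<close> the right-hand side is a contraction with
  constant \<open>max |k| (1 / 2)\<close> on bounded continuous functions.\<close>

lemma folded_transport_solution:
  fixes R M k :: real and A :: "real \<Rightarrow> real"
  assumes R: "R > 0" and M: "M > 0" and k: "\<bar>k\<bar> < 1"
    and A: "continuous_on {0..R} A" and A0: "A 0 = k * A R"
  obtains u :: "real \<Rightarrow> real \<Rightarrow> real" where
    "continuous_on UNIV (\<lambda>(t, y). u t y)"
    "\<And>y. y \<in> {0..R} \<Longrightarrow> u 0 y = A y"
    "\<And>t. 0 \<le> t \<Longrightarrow> u t 0 = k * u t R"
    "\<And>t y. 0 < t \<Longrightarrow> 0 < y \<Longrightarrow> y < R \<Longrightarrow> ((\<lambda>s. u (t + s) (y + s)) has_real_derivative - (M * u t (R - y))) (at 0)"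
proof -
  define \<gamma> where "\<gamma> = 2 * M"
  have \<gamma>: "\<gamma> > 0" using M by (simp add: \<gamma>_def)
  define B where "B y = A (max 0 (min R y))" for y
  have Bcont: "continuous_on S (\<lambda>x. B (g x))" if "continuous_on S g" for S and g :: "real \<times> real \<Rightarrow> real"
    unfolding B_def by (rule continuous_on_compose2[OF A]) (use R that in \<open>auto intro!: continuous_intros\<close>)
  have B_eq: "B y = A y" if "y \<in> {0..R}" for y using that by (simp add: B_def max_absorb2 min_absorb2)
  have "bounded (A ` {0..R})"
    by (intro compact_imp_bounded compact_continuous_image A) auto
  then obtain b where "\<forall>y\<in>A ` {0..R}. norm y \<le> b" unfolding bounded_iff by blast
  then have b: "\<bar>B y\<bar> \<le> b" for y using R by (simp add: B_def)
  \<comment> \<open>clamping makes the operator act on functions on the whole plane\<close>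
  define T where "T z = max 0 (fst z)" for z :: "real \<times> real"
  define Y where "Y z = max 0 (min R (snd z))" for z :: "real \<times> real"
  define l where "l z = min (T z) (Y z)" for z
  have TY: "0 \<le> l z" "l z \<le> T z" "l z \<le> Y z" "0 \<le> T z" "0 \<le> Y z" "Y z \<le> R" "l z \<le> R" for z
    using R by (auto simp: l_def T_def Y_def)
  have cTY [continuous_intros]: "continuous_on S (\<lambda>x. T (g x))" "continuous_on S (\<lambda>x. Y (g x))" "continuous_on S (\<lambda>x. l (g x))"
    if "continuous_on S g" for S and g :: "'x::topological_space \<Rightarrow> real \<times> real"
    unfolding l_def T_def Y_def using that by (auto intro!: continuous_intros)
  define K where "K w z = (\<lambda>\<theta>. exp (- \<gamma> * (l z * (1 - \<theta>))) * w (T z - l z + l z * \<theta>, R - Y z + l z - l z * \<theta>))"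
    for w :: "real \<times> real \<Rightarrow> real" and z
  define \<Phi> where "\<Phi> w z = exp (- \<gamma> * T z) * (B (Y z - l z) - k * B R) + k * exp (- \<gamma> * l z) * w (T z - l z, R)
      - M * (l z * integral {0..1} (K w z))" for w z
  have wcont: "continuous_on S (\<lambda>x. apply_bcontfun w (g x))"
    if "continuous_on S g" for w :: "(real \<times> real) \<Rightarrow>\<^sub>C real" and S and g :: "'x::topological_space \<Rightarrow> real \<times> real"
    by (rule continuous_on_compose2[OF continuous_on_apply_bcontfun that]) auto
  have Kcont: "continuous_on (UNIV \<times> {0..1}) (\<lambda>(z, \<theta>). K (apply_bcontfun w) z \<theta>)" for w
    unfolding K_def split_beta by (auto intro!: continuous_intros wcont)
  have Kint: "K (apply_bcontfun w) z integrable_on {0..1}" for w z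
    by (intro integrable_continuous_real continuous_on_compose_pair[OF Kcont]) auto
  have weight: "((\<lambda>\<theta>. l z * exp (- \<gamma> * (l z * (1 - \<theta>)))) has_integral (1 - exp (- \<gamma> * l z)) / \<gamma>) {0..1}" for z
  proof -
    have "((\<lambda>\<theta>. l z * exp (- \<gamma> * (l z * (1 - \<theta>)))) has_integral
        exp (- \<gamma> * (l z * (1 - 1))) / \<gamma> - exp (- \<gamma> * (l z * (1 - 0))) / \<gamma>) {0..1}"
      by (rule fundamental_theorem_of_calculus)
        (use \<gamma> in \<open>auto intro!: derivative_eq_intros simp: has_real_derivative_iff_has_vector_derivative[symmetric]\<close>)
    then show ?thesis by (simp add: diff_divide_distrib)
  qed
  have K_diff: "\<bar>l z * integral {0..1} (K (apply_bcontfun w) z) - l z * integral {0..1} (K (apply_bcontfun v) z)\<bar>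
      \<le> (1 - exp (- \<gamma> * l z)) / \<gamma> * dist w v" for w v z
  proof -
    have "l z * integral {0..1} (K (apply_bcontfun w) z) - l z * integral {0..1} (K (apply_bcontfun v) z)
       = integral {0..1} (\<lambda>\<theta>. l z * (K (apply_bcontfun w) z \<theta> - K (apply_bcontfun v) z \<theta>))"
      using Kint by (simp add: Henstock_Kurzweil_Integration.integral_diff right_diff_distrib[symmetric])
    also have "norm \<dots> \<le> integral {0..1} (\<lambda>\<theta>. l z * exp (- \<gamma> * (l z * (1 - \<theta>))) * dist w v)"
    proof (rule integral_norm_bound_integral)
      fix \<theta> :: real assume \<theta>: "\<theta> \<in> {0..1}"
      let ?z = "(T z - l z + l z * \<theta>, R - Y z + l z - l z * \<theta>)"
      have "norm (l z * (K (apply_bcontfun w) z \<theta> - K (apply_bcontfun v) z \<theta>))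
          = l z * exp (- \<gamma> * (l z * (1 - \<theta>))) * dist (apply_bcontfun w ?z) (apply_bcontfun v ?z)"
        using TY(1)[of z] by (simp add: K_def right_diff_distrib[symmetric] abs_mult dist_real_def)
      then show "norm (l z * (K (apply_bcontfun w) z \<theta> - K (apply_bcontfun v) z \<theta>)) \<le> l z * exp (- \<gamma> * (l z * (1 - \<theta>))) * dist w v"
        using TY(1)[of z] by (simp add: mult_left_mono dist_bounded)
    next
      show "(\<lambda>\<theta>. l z * (K (apply_bcontfun w) z \<theta> - K (apply_bcontfun v) z \<theta>)) integrable_on {0..1}"
        by (intro integrable_on_mult_right integrable_diff Kint)
      show "(\<lambda>\<theta>. l z * exp (- \<gamma> * (l z * (1 - \<theta>))) * dist w v) integrable_on {0..1}"
        by (intro integrable_continuous_real continuous_intros)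
    qed
    also have "\<dots> = (1 - exp (- \<gamma> * l z)) / \<gamma> * dist w v"
      using integral_unique[OF weight[of z]] by simp
    finally show ?thesis by simp
  qed
  have exp_l: "0 < exp (- \<gamma> * l z)" "exp (- \<gamma> * l z) \<le> 1" for z
    using \<gamma> TY(1)[of z] by auto
  define q where "q = max \<bar>k\<bar> (1 / 2)"
  have q: "0 \<le> q" "q < 1" using k by (auto simp: q_def)
  have contraction: "\<bar>\<Phi> (apply_bcontfun w) z - \<Phi> (apply_bcontfun v) z\<bar> \<le> q * dist w v" for w v z
  proof -
    let ?e = "exp (- \<gamma> * l z)" and ?z = "(T z - l z, R)"
    have "\<Phi> (apply_bcontfun w) z - \<Phi> (apply_bcontfun v) z
      = k * ?e * (apply_bcontfun w ?z - apply_bcontfun v ?z)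
        - M * (l z * integral {0..1} (K (apply_bcontfun w) z) - l z * integral {0..1} (K (apply_bcontfun v) z))"
      by (simp add: \<Phi>_def algebra_simps)
    also have "\<bar>\<dots>\<bar> \<le> \<bar>k\<bar> * ?e * dist w v + M * ((1 - ?e) / \<gamma> * dist w v)"
    proof (rule order_trans[OF abs_triangle_ineq4] add_mono)+
      show "\<bar>k * ?e * (apply_bcontfun w ?z - apply_bcontfun v ?z)\<bar> \<le> \<bar>k\<bar> * ?e * dist w v"
        using dist_bounded[of w ?z v] by (simp add: abs_mult dist_real_def mult_left_mono)
      show "\<bar>M * (l z * integral {0..1} (K (apply_bcontfun w) z) - l z * integral {0..1} (K (apply_bcontfun v) z))\<bar>
          \<le> M * ((1 - ?e) / \<gamma> * dist w v)"
        unfolding abs_mult using M K_diff[of z w v] by (intro mult_mono) auto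
    qed
    also have "\<dots> = (\<bar>k\<bar> * ?e + 1 / 2 * (1 - ?e)) * dist w v"
      using M by (simp add: \<gamma>_def field_simps)
    also have "\<dots> \<le> (q * ?e + q * (1 - ?e)) * dist w v"
      using exp_l[of z] by (intro mult_right_mono add_mono) (auto simp: q_def)
    finally show ?thesis by (simp add: algebra_simps)
  qed
  have \<Phi>_bcontfun: "\<Phi> (apply_bcontfun w) \<in> bcontfun" for w
  proof (rule bcontfun_normI)
    have "continuous_on UNIV (\<lambda>z. integral (cbox 0 1) (K (apply_bcontfun w) z))"
      by (rule integral_continuous_on_param) (use Kcont in simp)
    then show "continuous_on UNIV (\<Phi> (apply_bcontfun w))"
      unfolding \<Phi>_def by (auto intro!: continuous_intros wcont Bcont)
    fix z
    have zero: "\<bar>\<Phi> (apply_bcontfun 0) z\<bar> \<le> 2 * b"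
    proof -
      have "\<Phi> (apply_bcontfun 0) z = exp (- \<gamma> * T z) * (B (Y z - l z) - k * B R)"
        by (simp add: \<Phi>_def K_def)
      also have "\<bar>\<dots>\<bar> \<le> 1 * (b + 1 * b)"
      proof -
        have "\<bar>k * B R\<bar> \<le> 1 * b" unfolding abs_mult using k b[of R] by (intro mult_mono) auto
        then have "\<bar>B (Y z - l z) - k * B R\<bar> \<le> b + 1 * b" using b[of "Y z - l z"] by linarith
        moreover have "\<bar>exp (- \<gamma> * T z)\<bar> \<le> 1" using \<gamma> TY(4)[of z] by simp
        ultimately show ?thesis unfolding abs_mult by (intro mult_mono) auto
      qed
      finally show ?thesis by simp
    qed
    show "norm (\<Phi> (apply_bcontfun w) z) \<le> 2 * b + q * dist w 0"
      using contraction[of w z 0] zero by simp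
  qed
  define F where "F w = Bcontfun (\<Phi> (apply_bcontfun w))" for w
  have F: "apply_bcontfun (F w) = \<Phi> (apply_bcontfun w)" for w
    unfolding F_def by (rule Bcontfun_inverse[OF \<Phi>_bcontfun])
  have "\<exists>!w. F w = w"
  proof (rule banach_fix_type[OF q])
    show "\<forall>w v. dist (F w) (F v) \<le> q * dist w v"
      using contraction by (auto intro!: dist_bound simp: F dist_real_def)
  qed
  then obtain W where W: "F W = W" by blast
  define w where "w = apply_bcontfun W"
  have fixpoint: "w z = \<Phi> w z" for z
    unfolding w_def using F[of W] W by simp
  have w_cont: "continuous_on S (\<lambda>x. w (g x))" if "continuous_on S g" for S and g :: "'x::topological_space \<Rightarrow> real \<times> real"
    unfolding w_def by (rule wcont[OF that])
  define u where "u t y = exp (\<gamma> * t) * w (t, y)" for t y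
  have u_cont: "continuous_on S (\<lambda>x. u (f x) (g x))" if "continuous_on S f" "continuous_on S g"
    for S and f g :: "'x::topological_space \<Rightarrow> real"
    unfolding u_def using that by (intro continuous_intros w_cont)
  have u_eq: "u t y = B (y - \<sigma>) - k * B R + k * u (t - \<sigma>) R
       - M * integral {0..\<sigma>} (\<lambda>s. u (t - \<sigma> + s) (R - y + \<sigma> - s))"
    if "0 \<le> t" "y \<in> {0..R}" and \<sigma>: "\<sigma> = min t y" for t y \<sigma>
  proof -
    let ?z = "(t, y)"
    have z: "T ?z = t" "Y ?z = y" "l ?z = \<sigma>" using that by (auto simp: T_def Y_def l_def)
    have "0 \<le> \<sigma>" using that by auto
    have e: "exp (\<gamma> * t) * exp (- \<gamma> * t) = 1" "exp (\<gamma> * t) * exp (- \<gamma> * s) = exp (\<gamma> * (t - s))" for s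
      by (simp_all add: exp_add[symmetric] algebra_simps)
    have "exp (\<gamma> * t) * integral {0..1} (K w ?z) = integral {0..1} (\<lambda>\<theta>. exp (\<gamma> * t) * K w ?z \<theta>)"
      by simp
    also have "(\<lambda>\<theta>. exp (\<gamma> * t) * K w ?z \<theta>) = (\<lambda>\<theta>. u (t - \<sigma> + \<sigma> * \<theta>) (R - y + \<sigma> - \<sigma> * \<theta>))"
    proof
      fix \<theta>
      have "exp (\<gamma> * t) * exp (- \<gamma> * (\<sigma> * (1 - \<theta>))) = exp (\<gamma> * (t - \<sigma> + \<sigma> * \<theta>))"
        unfolding e by (simp add: algebra_simps)
      then show "exp (\<gamma> * t) * K w ?z \<theta> = u (t - \<sigma> + \<sigma> * \<theta>) (R - y + \<sigma> - \<sigma> * \<theta>)"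
        unfolding K_def z u_def by (simp only: mult.assoc[symmetric])
    qed
    finally have I: "\<sigma> * (exp (\<gamma> * t) * integral {0..1} (K w ?z)) = integral {0..\<sigma>} (\<lambda>s. u (t - \<sigma> + s) (R - y + \<sigma> - s))"
      using integral_rescale[OF \<open>0 \<le> \<sigma>\<close>, of "\<lambda>s. u (t - \<sigma> + s) (R - y + \<sigma> - s)"]
      by (simp add: u_cont continuous_intros)
    have "u t y = (exp (\<gamma> * t) * exp (- \<gamma> * t)) * (B (y - \<sigma>) - k * B R) + k * ((exp (\<gamma> * t) * exp (- \<gamma> * \<sigma>)) * w (t - \<sigma>, R))
        - M * (\<sigma> * (exp (\<gamma> * t) * integral {0..1} (K w ?z)))"
      unfolding u_def fixpoint[of ?z] \<Phi>_def z by (simp only: algebra_simps)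
    then show ?thesis
      unfolding I e by (simp add: u_def)
  qed
  show thesis
  proof (rule that)
    show "continuous_on UNIV (\<lambda>(t, y). u t y)"
      unfolding split_beta by (intro u_cont continuous_intros)
    \<comment> \<open>the fixed point equation at \<open>(0, R)\<close> reads \<open>u - A = k (u - A)\<close>, and \<open>k\<close> is not 1\<close>
    have uR: "u 0 R = A R"
    proof -
      have "(1 - k) * (u 0 R - A R) = 0"
        using u_eq[of 0 R 0] R by (simp add: B_eq algebra_simps)
      then show ?thesis using k by auto
    qed
    show "u 0 y = A y" if "y \<in> {0..R}" for y
      using u_eq[of 0 y 0] that uR R by (simp add: B_eq)
    show "u t 0 = k * u t R" if "0 \<le> t" for t
      using u_eq[of t 0 0] that A0 R by (simp add: B_eq)
    fix t y :: real assume t: "0 < t" and y: "0 < y" "y < R"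
    define \<sigma> where "\<sigma> = min t y"
    define U where "U = {max (- t) (- y)<..<R - y}"
    have U: "open U" "0 \<in> U" using t y by (auto simp: U_def)
    define h where "h s = u (t - \<sigma> + s) (R - y + \<sigma> - s)" for s
    have eq: "u (t + s) (y + s) = B (y - \<sigma>) - k * B R + k * u (t - \<sigma>) R - M * integral {0..\<sigma> + s} h" if "s \<in> U" for s
    proof -
      have min: "\<sigma> + s = min (t + s) (y + s)" by (simp add: \<sigma>_def min_add_distrib_left)
      have shift: "t + s - (\<sigma> + s) = t - \<sigma>" "y + s - (\<sigma> + s) = y - \<sigma>" "R - (y + s) + (\<sigma> + s) = R - y + \<sigma>"
        by simp_all
      show ?thesis
        unfolding h_def[abs_def] by (rule u_eq[OF _ _ min, unfolded shift]) (use that in \<open>auto simp: U_def\<close>)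
    qed
    have "((\<lambda>x. integral {0..x} h) has_real_derivative h \<sigma>) (at \<sigma> within {0..\<sigma> + 1})"
      by (rule integral_has_real_derivative) (use t y in \<open>auto simp: h_def \<sigma>_def intro!: u_cont continuous_intros\<close>)
    moreover have "at \<sigma> within {0..\<sigma> + 1} = at \<sigma>"
      by (rule at_within_interior) (use t y in \<open>simp add: \<sigma>_def\<close>)
    ultimately have "((\<lambda>s. integral {0..\<sigma> + s} h) has_real_derivative h \<sigma>) (at 0)"
      using DERIV_shift[of "\<lambda>x. integral {0..x} h" "h \<sigma>" 0 \<sigma>] by (simp add: add.commute)
    then have "((\<lambda>s. B (y - \<sigma>) - k * B R + k * u (t - \<sigma>) R - M * integral {0..\<sigma> + s} h) has_real_derivative - (M * h \<sigma>)) (at 0)"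
      by (auto intro!: derivative_eq_intros)
    moreover have "h \<sigma> = u t (R - y)" by (simp add: h_def)
    ultimately show "((\<lambda>s. u (t + s) (y + s)) has_real_derivative - (M * u t (R - y))) (at 0)"
      using has_field_derivative_transform_within_open[OF _ U, of _ _ "\<lambda>s. u (t + s) (y + s)"] eq by simp
  qed
qed

text \<open>Unfold the interval at \<open>x = L\<close>: the right half of \<open>[0, 2 L]\<close> carries \<open>\<delta>\<^sub>-\<close> in reversed direction. The
  condition \<open>a L = b L\<close> makes the unfolded initial state continuous, and the boundary
  condition at \<open>x = L\<close> holds automatically, as both components there are the value at the midpoint.\<close>

lemma mild_solution_exists:
  assumes L: "L > 0" and M: "M > 0" and k: "\<bar>k\<bar> < 1"
    and a: "continuous_on {0..L} a" and b: "continuous_on {0..L} b" and aL: "a L = b L" and a0: "a 0 = k * b 0"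
  obtains p m where "mild_solution L M k p m" "\<And>x. x \<in> {0..L} \<Longrightarrow> p 0 x = a x \<and> m 0 x = b x"
proof -
  define A where "A y = (if y \<le> L then a y else b (2 * L - y))" for y
  have A: "continuous_on {0..2 * L} A"
    unfolding A_def
  proof (rule continuous_on_cases_le)
    show "continuous_on {y \<in> {0..2 * L}. y \<le> L} a" by (rule continuous_on_subset[OF a]) auto
    show "continuous_on {y \<in> {0..2 * L}. L \<le> y} (\<lambda>y. b (2 * L - y))"
      by (rule continuous_on_compose2[OF b]) (auto intro!: continuous_intros)
  qed (use aL in \<open>auto intro!: continuous_intros\<close>)
  have A0: "A 0 = k * A (2 * L)" using L a0 by (simp add: A_def)
  have "2 * L > 0" using L by simp
  then obtain u where u: "continuous_on UNIV (\<lambda>(t, y). u t y)"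
    "\<And>y. y \<in> {0..2 * L} \<Longrightarrow> u 0 y = A y"
    "\<And>t. 0 \<le> t \<Longrightarrow> u t 0 = k * u t (2 * L)"
    "\<And>t y. 0 < t \<Longrightarrow> 0 < y \<Longrightarrow> y < 2 * L \<Longrightarrow> ((\<lambda>s. u (t + s) (y + s)) has_real_derivative - (M * u t (2 * L - y))) (at 0)"
    by (rule folded_transport_solution[OF _ M k A A0]) (rule that)
  have cont: "continuous_on S (\<lambda>z. u (f z) (g z))" if "continuous_on S f" "continuous_on S g"
    for S and f g :: "real \<times> real \<Rightarrow> real"
    by (rule continuous_on_compose_pair[of UNIV UNIV]) (use u(1) that in auto)
  show thesis
  proof (rule that)
    show "mild_solution L M k u (\<lambda>t x. u t (2 * L - x))"
      unfolding mild_solution_def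
    proof (intro conjI allI impI)
      fix t x :: real assume t: "0 < t" and x: "0 < x" "x < L"
      show "((\<lambda>s. u (t + s) (x + s)) has_real_derivative - (M * u t (2 * L - x))) (at 0)"
        by (rule u(4)) (use t x in auto)
      show "((\<lambda>s. u (t + s) (2 * L - (x - s))) has_real_derivative - (M * u t x)) (at 0)"
        using u(4)[of t "2 * L - x"] t x by (simp add: algebra_simps)
    qed (use u(3) in \<open>auto simp: split_beta intro!: cont continuous_intros\<close>)
    show "u 0 x = a x \<and> u 0 (2 * L - x) = b x" if "x \<in> {0..L}" for x
      using that aL u(2)[of x] u(2)[of "2 * L - x"] by (auto simp: A_def)
  qed
qed

section \<open>Exponential stability\<close>

lemma L2_norm2_eq:
  assumes "continuous_on {0..L} f" "continuous_on {0..L} g"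
  shows "L2_norm2 L f g = sqrt (integral {0..L} (\<lambda>x. (f x)\<^sup>2 + (g x)\<^sup>2))"
proof -
  have sq: "(LINT x:{0<..<L}|lborel. (h x)\<^sup>2) = integral {0..L} (\<lambda>x. (h x)\<^sup>2)" if "continuous_on {0..L} h" for h :: "real \<Rightarrow> real"
  proof -
    have "set_integrable lborel {0..L} (\<lambda>x. (h x)\<^sup>2)"
      using that by (intro borel_integrable_atLeastAtMost' continuous_intros)
    then have "set_integrable lborel {0<..<L} (\<lambda>x. (h x)\<^sup>2)"
      by (rule set_integrable_subset) auto
    then show ?thesis
      by (simp add: set_borel_integral_eq_integral(2) integral_open_interval_real)
  qed
  have "integral {0..L} (\<lambda>x. (f x)\<^sup>2 + (g x)\<^sup>2) = integral {0..L} (\<lambda>x. (f x)\<^sup>2) + integral {0..L} (\<lambda>x. (g x)\<^sup>2)"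
    using assms by (intro Henstock_Kurzweil_Integration.integral_add integrable_continuous_real continuous_intros)
  then show ?thesis by (simp add: L2_norm2_def sq assms)
qed

lemma mild_solution_diff:
  assumes "mild_solution L M k p m" "mild_solution L M k p' m'"
  shows "mild_solution L M k (\<lambda>t x. p t x - p' t x) (\<lambda>t x. m t x - m' t x)"
proof -
  note sol = assms[unfolded mild_solution_def]
  show ?thesis
    unfolding mild_solution_def
  proof (intro conjI allI impI)
    fix t x :: real assume tx: "0 < t" "0 < x" "x < L"
    have "((\<lambda>s. p (t + s) (x + s)) has_real_derivative - (M * m t x)) (at 0)"
      "((\<lambda>s. p' (t + s) (x + s)) has_real_derivative - (M * m' t x)) (at 0)"
      "((\<lambda>s. m (t + s) (x - s)) has_real_derivative - (M * p t x)) (at 0)"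
      "((\<lambda>s. m' (t + s) (x - s)) has_real_derivative - (M * p' t x)) (at 0)"
      using sol tx by simp_all
    note deriv = DERIV_diff[OF this(1,2)] DERIV_diff[OF this(3,4)]
    show "((\<lambda>s. p (t + s) (x + s) - p' (t + s) (x + s)) has_real_derivative - (M * (m t x - m' t x))) (at 0)"
      by (rule DERIV_cong[OF deriv(1)]) (simp add: algebra_simps)
    show "((\<lambda>s. m (t + s) (x - s) - m' (t + s) (x - s)) has_real_derivative - (M * (p t x - p' t x))) (at 0)"
      by (rule DERIV_cong[OF deriv(2)]) (simp add: algebra_simps)
  next
    show "continuous_on ({0..} \<times> {0..L}) (\<lambda>(t, x). p t x - p' t x)"
      "continuous_on ({0..} \<times> {0..L}) (\<lambda>(t, x). m t x - m' t x)"
      using sol unfolding case_prod_unfold by (intro continuous_on_diff; blast)+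
  next
    fix t :: real assume "0 \<le> t"
    then have "p t 0 = k * m t 0" "p' t 0 = k * m' t 0" "m t L = p t L" "m' t L = p' t L"
      using sol by simp_all
    then show "p t 0 - p' t 0 = k * (m t 0 - m' t 0)" "m t L - m' t L = p t L - p' t L"
      by (simp_all add: right_diff_distrib)
  qed
qed

theorem proposition3:
  fixes L M k :: real
  assumes "L > 0" and "M > 0"
    and "M * L < 1 / 2"
    and "\<bar>k\<bar> < 1"
  shows "exponentially_stable L M k
    {(a, b). a \<in> H1 L \<and> b \<in> H1 L \<and> a L = b L \<and> a 0 = k * b 0}"
proof -
  define E where "E p m t = integral {0..L} (\<lambda>x. (p t x)\<^sup>2 + (m t x)\<^sup>2)" for p m :: "real \<Rightarrow> real \<Rightarrow> real" and t
  from mild_solution_decay[OF assms] obtain C c where "C > 0" "c > 0" and decay: "\<And>p m t. mild_solution L M k p m \<Longrightarrow> 0 \<le> t \<Longrightarrow>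
      E p m t \<le> C * exp (- c * t) * E p m 0"
    unfolding E_def by blast
  have slice: "continuous_on {0..L} (p t)" "continuous_on {0..L} (m t)" if "mild_solution L M k p m" "0 \<le> t" for p m t
  proof -
    note sol = that(1)[unfolded mild_solution_def]
    show "continuous_on {0..L} (p t)"
      by (rule continuous_on_compose_pair[OF sol[THEN conjunct1]]) (use that(2) in auto)
    show "continuous_on {0..L} (m t)"
      by (rule continuous_on_compose_pair[OF sol[THEN conjunct2, THEN conjunct1]]) (use that(2) in auto)
  qed
  have norm_eq: "L2_norm2 L (p t) (m t) = sqrt (E p m t)" if "mild_solution L M k p m" "0 \<le> t" for p m t
    unfolding E_def by (rule L2_norm2_eq[OF slice[OF that]])
  have norm_decay: "L2_norm2 L (p t) (m t) \<le> sqrt C * exp (- (c / 2) * t) * L2_norm2 L (p 0) (m 0)"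
    if "mild_solution L M k p m" "0 \<le> t" for p m t
  proof -
    have "exp (- c * t) = (exp (- (c / 2) * t))\<^sup>2"
      by (simp add: exp_double[symmetric])
    then have "sqrt (C * exp (- c * t) * E p m 0) = sqrt C * exp (- (c / 2) * t) * sqrt (E p m 0)"
      by (simp add: real_sqrt_mult)
    then show ?thesis
      using real_sqrt_le_mono[OF decay[OF that]] norm_eq[OF that] norm_eq[OF that(1) order_refl] by simp
  qed
  have unique: "p t x = p' t x \<and> m t x = m' t x"
    if sol: "mild_solution L M k p m" "mild_solution L M k p' m'"
      and init: "\<And>x. x \<in> {0..L} \<Longrightarrow> p 0 x = p' 0 x \<and> m 0 x = m' 0 x" and t: "0 \<le> t" and x: "x \<in> {0..L}"
    for p m p' m' t x
  proof -
    let ?p = "\<lambda>t x. p t x - p' t x" and ?m = "\<lambda>t x. m t x - m' t x"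
    note diff = mild_solution_diff[OF sol]
    have cont: "continuous_on {0..L} (\<lambda>x. (?p t x)\<^sup>2 + (?m t x)\<^sup>2)"
      by (intro continuous_on_add continuous_on_power slice[OF diff t])
    have "E ?p ?m 0 = integral {0..L} (\<lambda>x. 0)"
      unfolding E_def by (rule integral_cong) (simp add: init)
    then have "E ?p ?m t \<le> 0" using decay[OF diff t] by simp
    moreover have "E ?p ?m t \<ge> 0"
      unfolding E_def by (rule integral_nonneg[OF integrable_continuous_real[OF cont]]) simp
    ultimately have "((\<lambda>x. (?p t x)\<^sup>2 + (?m t x)\<^sup>2) has_integral 0) (cbox 0 L)"
      using integrable_integral[OF integrable_continuous_real[OF cont]] by (simp add: E_def)
    then have "(?p t x)\<^sup>2 + (?m t x)\<^sup>2 = 0"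
      using has_integral_0_cbox_imp_0[of 0 L "\<lambda>x. (?p t x)\<^sup>2 + (?m t x)\<^sup>2" x] cont x assms(1) by simp
    then show ?thesis by (simp add: sum_power2_eq_zero_iff)
  qed
  show ?thesis
    unfolding exponentially_stable_def
  proof (intro exI conjI ballI)
    show "sqrt C > 0" "c / 2 > 0" using \<open>C > 0\<close> \<open>c > 0\<close> by auto
    fix ab assume "ab \<in> {(a, b). a \<in> H1 L \<and> b \<in> H1 L \<and> a L = b L \<and> a 0 = k * b 0}"
    then obtain a b where ab: "ab = (a, b)" "continuous_on {0..L} a" "continuous_on {0..L} b" "a L = b L" "a 0 = k * b 0"
      unfolding H1_def by auto
    obtain p m where sol: "mild_solution L M k p m" "\<And>x. x \<in> {0..L} \<Longrightarrow> p 0 x = a x \<and> m 0 x = b x"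
      by (rule mild_solution_exists[OF assms(1,2,4) ab(2-5)]) (rule that)
    have "closed_loop_solution L M k a b p m"
      using sol by (simp add: closed_loop_solution_iff_mild)
    moreover have "p' t x = p t x \<and> m' t x = m t x"
      if "closed_loop_solution L M k a b p' m'" "0 \<le> t" "x \<in> {0..L}" for p' m' t x
    proof (rule unique[OF _ sol(1) _ that(2,3)])
      show "mild_solution L M k p' m'"
        using that(1) by (simp add: closed_loop_solution_iff_mild)
      show "p' 0 x = p 0 x \<and> m' 0 x = m 0 x" if "x \<in> {0..L}" for x
        using \<open>closed_loop_solution L M k a b p' m'\<close> sol(2) that by (simp add: closed_loop_solution_iff_mild)
    qed
    ultimately show "case ab of (a, b) \<Rightarrow> \<exists>p m. closed_loop_solution L M k a b p m \<and>
        (\<forall>p' m'. closed_loop_solution L M k a b p' m' \<longrightarrow>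
           (\<forall>t\<ge>0. \<forall>x\<in>{0..L}. p' t x = p t x \<and> m' t x = m t x)) \<and>
        (\<forall>t\<ge>0. L2_norm2 L (p t) (m t) \<le> sqrt C * exp (- (c / 2) * t) * L2_norm2 L (p 0) (m 0))"
      unfolding ab(1) prod.case
      by (intro exI[of _ p] exI[of _ m] conjI allI impI ballI norm_decay[OF sol(1)]) blast+
  qed
qed

end
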